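(* Let $\mathcal C:\Sigma^{nR}\to\Sigma^n$ be an $(\alpha,l,L)$-list recoverable code with rate $R$, encoding complexity $T_{Enc}(\cdot)$ and decoding complexity $T_{Dec}(\cdot)$. For every $\varepsilon>0$ and $0\le\gamma\le\frac{l\varepsilon}{3}-1$, by indexing the codewords of $\mathcal C$ with an $\varepsilon_s$-synchronization string of length $n$ over an alphabet $\Sigma_s$, where $\varepsilon_s=\frac{\varepsilon^2}{9(1+\gamma)}$, and a near-linear-time $\varepsilon_I$-indexing sequence of length $n$ over an alphabet $\Sigma_I$, where $\varepsilon_I=\frac{\varepsilon}{3(1+\gamma/2)}$, one can obtain an $L$-list decodable insertion-deletion code $\mathcal C':\Sigma^{nR}\to[\Sigma\times\Sigma_s\times\Sigma_I]^n$ that corrects from a $\delta<1-\alpha-\varepsilon$ fraction of deletions and a $\gamma$ fraction of insertions. $\mathcal C'$ is encodable and decodable in $O(T_{Enc}(n)+n)$ and $O_{\varepsilon,\gamma}(T_{Dec}(n)+n\,\mathrm{poly}(\log n))$ time, respectively.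
   Context: $\mathrm{ED}(A,B)$ is the minimum number of single-character insertions and deletions (no substitutions) needed to transform $A$ into $B$. For strings $A,B$ of length $n$, $A\times B$ is the length-$n$ string whose $i$-th symbol is $(A_i,B_i)$. Indexing the codewords of $\mathcal C$ with strings $T\in\Sigma_s^n$ and $I\in\Sigma_I^n$ means replacing each codeword $x$ by the string whose $i$-th symbol is $(x_i,T_i,I_i)$. A code $\mathcal C\subseteq\Sigma^n$ is $(\alpha,l,L)$-list recoverable if for any sets $S_1,\dots,S_n\subset\Sigma$ each of size at most $l$, $|\{x\in\mathcal C:|\{i\in[n]:x_i\in S_i\}|\ge\alpha n\}|\le L$; its decoding complexity $T_{Dec}(n)$ is the time to compute this set of codewords from $S_1,\dots,S_n$. A code $\mathcal C'$ of block length $n$ is $L$-list decodable from a $\delta$ fraction of deletions and $\gamma$ fraction of insertions if there is a decoder that, given any string $\tilde x$ obtained from some codeword $x\in\mathcal C'$ by at most $\delta n$ deletions and at most $\gamma n$ insertions, outputs a list of at most $L$ codewords containing $x$. A string $T\in\Sigma_s^n$ is an $\varepsilon_s$-synchronization string if for all $1\le i<j<k\le n+1$, $\mathrm{ED}(T[i,j),T[j,k))>(1-\varepsilon_s)(k-i)$, where $T[i,j)$ is the substring at positions $i,\dots,j-1$. A near-linear-time $\varepsilon_I$-indexing sequence is a string $I\in\Sigma_I^n$ equipped with an algorithm which, given $W\times I$ for any string $W$ of length $n$ over any alphabet $\Gamma$ and any string $S''$ over $\Gamma\times\Sigma_I$ (of arbitrary length $O(n)$), outputs in $O_{\varepsilon_I}(n\,\mathrm{poly}(\log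 n))$ time a set of at most $(1+\varepsilon_I)\,\mathrm{ED}(W\times I,S'')$ symbol insertions and deletions turning $W\times I$ into $S''$. The synchronization string and indexing sequence are regarded as fixed, given strings (constructed once for the code). *)

theory Defs
  imports Complex_Main "HOL-Library.FuncSet"
begin

section \<open>Machine model\<close>

text \<open>
  Running times are measured on a unit-cost random access machine, presented as a structured
  programming language. A memory cell holds a number or a pointer to an immutable ordered pair,
  so a cell content is a finite binary tree. The variables of a program are the cells with fixed
  addresses; \<open>Load\<close> and \<open>Store\<close> address memory indirectly. A subroutine called by \<open>Call\<close>
  works on its own, initially zero, memory. Arithmetic is limited to addition and truncated
  subtraction, and all operations are total: a pair counts as the number 0 where a number is
  expected, and the components of a number are 0.
\<close>

datatype val = Num nat | Cell val val

fun num :: "val \<Rightarrow> nat" where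
  "num (Num k) = k"
| "num (Cell v w) = 0"

fun left :: "val \<Rightarrow> val" where
  "left (Num k) = Num 0"
| "left (Cell v w) = v"

fun right :: "val \<Rightarrow> val" where
  "right (Num k) = Num 0"
| "right (Cell v w) = w"

fun is_cell :: "val \<Rightarrow> bool" where
  "is_cell (Num k) = False"
| "is_cell (Cell v w) = True"

fun vsize :: "val \<Rightarrow> nat" where
  "vsize (Num k) = 1"
| "vsize (Cell v w) = 1 + vsize v + vsize w"

datatype guard = IsPos nat | IsCell nat

datatype prog =
    Const nat nat
  | Copy nat nat
  | Add nat nat nat
  | Sub nat nat nat
  | MkCell nat nat nat
  | Left nat nat
  | Right nat nat
  | Load nat nat
  | Store nat nat
  | Seq prog prog
  | Cond guard prog prog
  | While guard prog
  | Call prog nat nat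

type_synonym memory = "nat \<Rightarrow> val"

fun holds :: "guard \<Rightarrow> memory \<Rightarrow> bool" where
  "holds (IsPos x) s = (num (s x) > 0)"
| "holds (IsCell x) s = is_cell (s x)"

text \<open>Input and output are passed in cell 0.\<close>

definition init :: "val \<Rightarrow> memory" where
  "init v = (\<lambda>_. Num 0)(0 := v)"

text \<open>\<open>exec p s t s'\<close>: started in memory \<open>s\<close>, the program \<open>p\<close> halts after \<open>t\<close> steps in memory \<open>s'\<close>.
  The first argument of an instruction is the target; in \<open>Call p x y\<close> the input of \<open>p\<close> is
  taken from \<open>y\<close>.\<close>

inductive exec :: "prog \<Rightarrow> memory \<Rightarrow> nat \<Rightarrow> memory \<Rightarrow> bool" where
  Const: "exec (Const x k) s 1 (s(x := Num k))"
| Copy: "exec (Copy x y) s 1 (s(x := s y))"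
| Add: "exec (Add x y z) s 1 (s(x := Num (num (s y) + num (s z))))"
| Sub: "exec (Sub x y z) s 1 (s(x := Num (num (s y) - num (s z))))"
| MkCell: "exec (MkCell x y z) s 1 (s(x := Cell (s y) (s z)))"
| Left: "exec (Left x y) s 1 (s(x := left (s y)))"
| Right: "exec (Right x y) s 1 (s(x := right (s y)))"
| Load: "exec (Load x y) s 1 (s(x := s (num (s y))))"
| Store: "exec (Store x y) s 1 (s(num (s x) := s y))"
| Seq: "exec p s t s' \<Longrightarrow> exec q s' t' s'' \<Longrightarrow> exec (Seq p q) s (t + t') s''"
| CondTrue: "holds g s \<Longrightarrow> exec p s t s' \<Longrightarrow> exec (Cond g p q) s (1 + t) s'"
| CondFalse: "\<not> holds g s \<Longrightarrow> exec q s t s' \<Longrightarrow> exec (Cond g p q) s (1 + t) s'"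
| WhileFalse: "\<not> holds g s \<Longrightarrow> exec (While g p) s 1 s"
| WhileTrue: "holds g s \<Longrightarrow> exec p s t s' \<Longrightarrow> exec (While g p) s' t' s''
    \<Longrightarrow> exec (While g p) s (1 + t + t') s''"
| Call: "exec p (init (s y)) t s' \<Longrightarrow> exec (Call p x y) s (1 + t) (s(x := s' 0))"

text \<open>The running time includes the time for writing out the result, since several parts of a
  result may be pointers to the same pair.\<close>

definition runs_within :: "prog \<Rightarrow> val \<Rightarrow> val \<Rightarrow> real \<Rightarrow> bool" where
  "runs_within p v w B \<longleftrightarrow> (\<exists>t s. exec p (init v) t s \<and> s 0 = w \<and> real (t + vsize w) \<le> B)"

fun vlist :: "('a \<Rightarrow> val) \<Rightarrow> 'a list \<Rightarrow> val" where
  "vlist f [] = Num 0"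
| "vlist f (a # as) = Cell (f a) (vlist f as)"

fun vpair :: "('a \<Rightarrow> val) \<Rightarrow> ('b \<Rightarrow> val) \<Rightarrow> 'a \<times> 'b \<Rightarrow> val" where
  "vpair f g (a, b) = Cell (f a) (g b)"

text \<open>The symbols of the basic alphabets are numbers.\<close>

abbreviation vstr :: "nat list \<Rightarrow> val" where
  "vstr \<equiv> vlist Num"

abbreviation vstr2 :: "(nat \<times> nat) list \<Rightarrow> val" where
  "vstr2 \<equiv> vlist (vpair Num Num)"

abbreviation vstr3 :: "(nat \<times> nat \<times> nat) list \<Rightarrow> val" where
  "vstr3 \<equiv> vlist (vpair Num (vpair Num Num))"


section \<open>Insertions and deletions\<close>

text \<open>\<open>indel x d i y\<close>: some sequence of \<open>d\<close> deletions and \<open>i\<close> insertions, in any order,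
  turns \<open>x\<close> into \<open>y\<close>.\<close>

inductive indel :: "'a list \<Rightarrow> nat \<Rightarrow> nat \<Rightarrow> 'a list \<Rightarrow> bool" for x where
  refl: "indel x 0 0 x"
| delete: "indel x d i (u @ a # v) \<Longrightarrow> indel x (Suc d) i (u @ v)"
| insert: "indel x d i (u @ v) \<Longrightarrow> indel x d (Suc i) (u @ a # v)"

definition ED :: "'a list \<Rightarrow> 'a list \<Rightarrow> nat" where
  "ED x y = (LEAST k. \<exists>d i. k = d + i \<and> indel x d i y)"

text \<open>A concrete set of insertions and deletions, listed along the string they are applied to.\<close>

datatype 'a edit = Keep | Delete | Insert 'a

inductive edits :: "'a edit list \<Rightarrow> 'a list \<Rightarrow> 'a list \<Rightarrow> bool" where
  "edits [] [] []"
| "edits es x y \<Longrightarrow> edits (Keep # es) (a # x) (a # y)"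
| "edits es x y \<Longrightarrow> edits (Delete # es) (a # x) y"
| "edits es x y \<Longrightarrow> edits (Insert a # es) x (a # y)"

definition num_edits :: "'a edit list \<Rightarrow> nat" where
  "num_edits es = length (filter (\<lambda>e. e \<noteq> Keep) es)"

fun vedit :: "('a \<Rightarrow> val) \<Rightarrow> 'a edit \<Rightarrow> val" where
  "vedit f Keep = Num 0"
| "vedit f Delete = Num 1"
| "vedit f (Insert a) = Cell (Num 2) (f a)"


section \<open>Codes\<close>

definition strings :: "'a set \<Rightarrow> nat \<Rightarrow> 'a list set" where
  "strings A n = {x. length x = n \<and> set x \<subseteq> A}"

text \<open>An encoding function of a code with messages in \<open>A^k\<close> and codewords in \<open>B^n\<close>.\<close>

definition encoding :: "'a set \<Rightarrow> nat \<Rightarrow> 'b set \<Rightarrow> nat \<Rightarrow> ('a list \<Rightarrow> 'b list) \<Rightarrow> bool" where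
  "encoding A k B n C \<longleftrightarrow>
     finite A \<and> finite B \<and> C \<in> strings A k \<rightarrow> strings B n \<and> inj_on C (strings A k)"

definition agreeing :: "'a list set \<Rightarrow> nat \<Rightarrow> real \<Rightarrow> (nat \<Rightarrow> 'a set) \<Rightarrow> 'a list set" where
  "agreeing CW n \<alpha> S = {x \<in> CW. real (card {i. i < n \<and> x ! i \<in> S i}) \<ge> \<alpha> * real n}"

definition list_recoverable ::
  "'a list set \<Rightarrow> 'a set \<Rightarrow> nat \<Rightarrow> real \<Rightarrow> nat \<Rightarrow> nat \<Rightarrow> bool" where
  "list_recoverable CW A n \<alpha> l L \<longleftrightarrow>
     (\<forall>S. (\<forall>i<n. S i \<subseteq> A \<and> card (S i) \<le> l) \<longrightarrow> card (agreeing CW n \<alpha> S) \<le> L)"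

text \<open>Sets are passed to and returned by programs as duplicate-free lists in any order.
  The value \<open>a\<close> is a description of the code (its block length, precomputed matrices, ...).\<close>

definition recovers_within ::
  "prog \<Rightarrow> val \<Rightarrow> nat list set \<Rightarrow> nat set \<Rightarrow> nat \<Rightarrow> real \<Rightarrow> nat \<Rightarrow> real \<Rightarrow> bool" where
  "recovers_within p a CW A n \<alpha> l B \<longleftrightarrow>
     (\<forall>Ss. length Ss = n \<and> (\<forall>S\<in>set Ss. distinct S \<and> set S \<subseteq> A \<and> length S \<le> l) \<longrightarrow>
        (\<exists>xs. distinct xs \<and> set xs = agreeing CW n \<alpha> (\<lambda>i. set (Ss ! i)) \<and>
              runs_within p (Cell a (vlist vstr Ss)) (vlist vstr xs) B))"

definition corruptions :: "'a set \<Rightarrow> nat \<Rightarrow> real \<Rightarrow> real \<Rightarrow> 'a list \<Rightarrow> 'a list set" where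
  "corruptions A n \<delta> \<gamma> x =
     {y. set y \<subseteq> A \<and>
         (\<exists>d i. real d \<le> \<delta> * real n \<and> real i \<le> \<gamma> * real n \<and> indel x d i y)}"

definition list_decoder ::
  "('a list \<Rightarrow> 'a list list) \<Rightarrow> 'a list set \<Rightarrow> 'a set \<Rightarrow> nat \<Rightarrow> real \<Rightarrow> real \<Rightarrow> nat \<Rightarrow> bool" where
  "list_decoder D CW A n \<delta> \<gamma> L \<longleftrightarrow>
     (\<forall>x\<in>CW. \<forall>y\<in>corruptions A n \<delta> \<gamma> x.
        length (D y) \<le> L \<and> set (D y) \<subseteq> CW \<and> x \<in> set (D y))"


section \<open>Synchronization strings and indexing\<close>

definition slice :: "nat \<Rightarrow> nat \<Rightarrow> 'a list \<Rightarrow> 'a list" where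
  "slice i j x = take (j - i) (drop i x)"

definition synchronization_string :: "real \<Rightarrow> 'a list \<Rightarrow> bool" where
  "synchronization_string \<epsilon> T \<longleftrightarrow>
     (\<forall>i j k. i < j \<and> j < k \<and> k \<le> length T \<longrightarrow>
        real (ED (slice i j T) (slice j k T)) > (1 - \<epsilon>) * real (k - i))"

text \<open>The bound \<open>n poly(log n)\<close>, with \<open>1 + ln n\<close> for the logarithm so that it is meaningful
  for \<open>n = 1\<close>.\<close>

definition near_linear :: "nat \<Rightarrow> nat \<Rightarrow> real" where
  "near_linear d n = real n * (1 + ln (real n)) ^ d"

text \<open>For strings of length at most \<open>\<beta> n\<close> the running time of the algorithm \<open>p\<close> is at most
  \<open>c \<beta> * near_linear (d \<beta>) n\<close>.\<close>

definition near_linear_indexing ::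
  "prog \<Rightarrow> real \<Rightarrow> (real \<Rightarrow> real) \<Rightarrow> (real \<Rightarrow> nat) \<Rightarrow> nat set \<Rightarrow> nat list \<Rightarrow> bool" where
  "near_linear_indexing p \<epsilon> c d A I \<longleftrightarrow>
     (\<forall>\<beta> W S. length W = length I \<and> snd ` set S \<subseteq> A \<and>
        real (length S) \<le> \<beta> * real (length I) \<longrightarrow>
        (\<exists>es. edits es (zip W I) S \<and>
              real (num_edits es) \<le> (1 + \<epsilon>) * real (ED (zip W I) S) \<and>
              runs_within p (Cell (vstr2 (zip W I)) (vstr2 S)) (vlist (vedit (vpair Num Num)) es)
                (c \<beta> * near_linear (d \<beta>) (length I))))"

definition indexed :: "'b list \<Rightarrow> 'c list \<Rightarrow> 'a list \<Rightarrow> ('a \<times> 'b \<times> 'c) list" where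
  "indexed T I x = zip x (zip T I)"

end

theory Submission
  imports Defs
begin

text \<open>
  The decoder runs the indexing algorithm \<open>K = \<lfloor>3(1 + \<gamma>)/\<epsilon>\<rfloor> \<le> l\<close> times on \<open>T \<times> I\<close> and the index part of
  those received symbols that are still unmatched; after each round the matched symbols are removed
  and their \<open>\<Sigma>\<close>-components join the lists of the positions they were matched to. These lists have
  at most \<open>K\<close> elements and are passed to the list recovery algorithm.

  At least \<open>n - \<delta>n\<close> symbols are transmitted without corruption. One of them can only fail to
  contribute to the list of its own position in two ways. If it is matched to a wrong position in
  some round, then it yields a bad pair of a self-matching of \<open>T\<close>; these number at most \<open>\<epsilon>\<^sub>s n\<close> per round,
  hence \<open>K \<epsilon>\<^sub>s n \<le> \<epsilon>n/3\<close> in all. If it is never matched, it is among \<open>u\<close> such symbols, which form a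
  common subsequence available in every round, so every round matches at least
  \<open>(1 + \<epsilon>\<^sub>I) u - \<epsilon>n/3\<close> symbols, while all rounds together match at most \<open>(1 + \<gamma>) n - u\<close>. Since
  \<open>1 + \<gamma> \<le> (K + 1) \<epsilon>/3\<close>, this gives \<open>(K + 1) u \<le> (2K + 1) \<epsilon>n/3\<close> and \<open>u \<le> 2\<epsilon>n/3\<close>.
\<close>

section \<open>Structured programs\<close>

text \<open>The size of the output is left out here and charged only once, for the final result:
  intermediate results are passed on as pointers and never written out.\<close>

definition computes :: "prog \<Rightarrow> val \<Rightarrow> val \<Rightarrow> nat \<Rightarrow> bool" where
  "computes p v w c \<longleftrightarrow> (\<exists>t s. exec p (init v) t s \<and> s 0 = w \<and> t \<le> c)"

lemma computes_mono: "computes p v w c \<Longrightarrow> c \<le> c' \<Longrightarrow> computes p v w c'"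
  unfolding computes_def using le_trans by blast

lemma computesI: "exec p (init v) t s \<Longrightarrow> s 0 = w \<Longrightarrow> t \<le> c \<Longrightarrow> computes p v w c"
  unfolding computes_def by blast

lemma runs_within_computes:
  assumes "runs_within p v w B"
  obtains c where "computes p v w c" "real (c + vsize w) \<le> B"
  using assms unfolding runs_within_def computes_def by blast

lemma computes_runs_within:
  "computes p v w c \<Longrightarrow> real (c + vsize w) \<le> B \<Longrightarrow> runs_within p v w B"
  unfolding runs_within_def computes_def by force

text \<open>A call changes nothing but its target cell, so programs known only through
  \<open>computes\<close> can be composed without knowledge of the cells that they use.\<close>

lemma exec_call:
  assumes "computes p (s y) w c"
  obtains t where "exec (Call p x y) s t (s(x := w))" "t \<le> c + 1"
  using assms unfolding computes_def by (metis Call Suc_eq_plus1 Suc_le_mono plus_1_eq_Suc)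

section \<open>Loop-free expressions and their compilation\<close>

datatype expr =
    Input
  | Lit nat
  | Hd expr
  | Tl expr
  | Join expr expr
  | Plus expr expr
  | Minus expr expr
  | IfPos expr expr expr
  | IfCell expr expr expr
  | After expr expr

fun ev :: "expr \<Rightarrow> val \<Rightarrow> val" where
  "ev Input v = v"
| "ev (Lit k) v = Num k"
| "ev (Hd e) v = left (ev e v)"
| "ev (Tl e) v = right (ev e v)"
| "ev (Join e f) v = Cell (ev e v) (ev f v)"
| "ev (Plus e f) v = Num (num (ev e v) + num (ev f v))"
| "ev (Minus e f) v = Num (num (ev e v) - num (ev f v))"
| "ev (IfPos g e f) v = (if num (ev g v) > 0 then ev e v else ev f v)"
| "ev (IfCell g e f) v = (if is_cell (ev g v) then ev e v else ev f v)"
| "ev (After f e) v = ev f (ev e v)"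

text \<open>The operands of binary operations are evaluated by calls, each in fresh memory, so cell
  0 keeps the input until both results stand in cells 1 and 2. Straight-line code then needs no
  execution proofs of its own: simplifying \<open>ev\<close> gives its value and
  \<open>ecost\<close> bounds its time by a constant.\<close>

fun code :: "expr \<Rightarrow> prog" where
  "code Input = Copy 0 0"
| "code (Lit k) = Const 0 k"
| "code (Hd e) = Seq (code e) (Left 0 0)"
| "code (Tl e) = Seq (code e) (Right 0 0)"
| "code (Join e f) = Seq (Call (code e) 1 0) (Seq (Call (code f) 2 0) (MkCell 0 1 2))"
| "code (Plus e f) = Seq (Call (code e) 1 0) (Seq (Call (code f) 2 0) (Add 0 1 2))"
| "code (Minus e f) = Seq (Call (code e) 1 0) (Seq (Call (code f) 2 0) (Sub 0 1 2))"
| "code (IfPos g e f) =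
     Seq (Call (code g) 1 0) (Cond (IsPos 1) (Call (code e) 0 0) (Call (code f) 0 0))"
| "code (IfCell g e f) =
     Seq (Call (code g) 1 0) (Cond (IsCell 1) (Call (code e) 0 0) (Call (code f) 0 0))"
| "code (After f e) = Seq (Call (code e) 0 0) (Call (code f) 0 0)"

text \<open>A conditional is charged for both branches, so that the bound does not depend on the
  input.\<close>

fun ecost :: "expr \<Rightarrow> nat" where
  "ecost Input = 1"
| "ecost (Lit k) = 1"
| "ecost (Hd e) = ecost e + 1"
| "ecost (Tl e) = ecost e + 1"
| "ecost (Join e f) = ecost e + ecost f + 3"
| "ecost (Plus e f) = ecost e + ecost f + 3"
| "ecost (Minus e f) = ecost e + ecost f + 3"
| "ecost (IfPos g e f) = ecost g + ecost e + ecost f + 3"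
| "ecost (IfCell g e f) = ecost g + ecost e + ecost f + 3"
| "ecost (After f e) = ecost e + ecost f + 2"

lemma init_0 [simp]: "init v 0 = v"
  by (simp add: init_def)

lemma computes_binary:
  assumes "computes p v w c" "computes q v u d"
    and "\<And>s. exec r s 1 (s(0 := f (s 1) (s 2)))"
  shows "computes (Seq (Call p 1 0) (Seq (Call q 2 0) r)) v (f w u) (c + d + 3)"
proof -
  obtain t1 where 1: "exec (Call p 1 0) (init v) t1 ((init v)(1 := w))" "t1 \<le> c + 1"
    using exec_call[of p "init v" 0 w c 1] assms(1) by auto
  obtain t2 where 2: "exec (Call q 2 0) ((init v)(1 := w)) t2 ((init v)(1 := w, 2 := u))" "t2 \<le> d + 1"
    using exec_call[of q "(init v)(1 := w)" 0 u d 2] assms(2) by auto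
  have "exec (Seq (Call p 1 0) (Seq (Call q 2 0) r)) (init v) (t1 + (t2 + 1))
      ((init v)(1 := w, 2 := u, 0 := f w u))"
    using assms(3)[of "(init v)(1 := w, 2 := u)"] by (intro exec.Seq[OF 1(1)] exec.Seq[OF 2(1)]) simp
  then show ?thesis
    by (rule computesI) (use 1 2 in auto)
qed

lemma computes_branch:
  assumes "computes p v b c" "computes q v w d" and "\<And>s. s 1 = b \<Longrightarrow> holds g s"
  shows "computes (Seq (Call p 1 0) (Cond g (Call q 0 0) r)) v w (c + d + 3)"
proof -
  obtain t1 where 1: "exec (Call p 1 0) (init v) t1 ((init v)(1 := b))" "t1 \<le> c + 1"
    using exec_call[of p "init v" 0 b c 1] assms(1) by auto
  obtain t2 where 2: "exec (Call q 0 0) ((init v)(1 := b)) t2 ((init v)(1 := b, 0 := w))" "t2 \<le> d + 1"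
    using exec_call[of q "(init v)(1 := b)" 0 w d 0] assms(2) by auto
  have "exec (Seq (Call p 1 0) (Cond g (Call q 0 0) r)) (init v) (t1 + (1 + t2))
      ((init v)(1 := b, 0 := w))"
    using assms(3) by (intro exec.Seq[OF 1(1)] exec.CondTrue[OF _ 2(1)]) simp
  then show ?thesis
    by (rule computesI) (use 1 2 in auto)
qed

lemma computes_branch_else:
  assumes "computes p v b c" "computes q v w d" and "\<And>s. s 1 = b \<Longrightarrow> \<not> holds g s"
  shows "computes (Seq (Call p 1 0) (Cond g r (Call q 0 0))) v w (c + d + 3)"
proof -
  obtain t1 where 1: "exec (Call p 1 0) (init v) t1 ((init v)(1 := b))" "t1 \<le> c + 1"
    using exec_call[of p "init v" 0 b c 1] assms(1) by auto
  obtain t2 where 2: "exec (Call q 0 0) ((init v)(1 := b)) t2 ((init v)(1 := b, 0 := w))" "t2 \<le> d + 1"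
    using exec_call[of q "(init v)(1 := b)" 0 w d 0] assms(2) by auto
  have "exec (Seq (Call p 1 0) (Cond g r (Call q 0 0))) (init v) (t1 + (1 + t2))
      ((init v)(1 := b, 0 := w))"
    using assms(3) by (intro exec.Seq[OF 1(1)] exec.CondFalse[OF _ 2(1)]) simp
  then show ?thesis
    by (rule computesI) (use 1 2 in auto)
qed

lemma computes_seq:
  assumes "computes p v w c" "computes q w u d"
  shows "computes (Seq (Call p 0 0) (Call q 0 0)) v u (c + d + 2)"
proof -
  obtain t1 where 1: "exec (Call p 0 0) (init v) t1 ((init v)(0 := w))" "t1 \<le> c + 1"
    using exec_call[of p "init v" 0 w c 0] assms(1) by auto
  obtain t2 where 2: "exec (Call q 0 0) ((init v)(0 := w)) t2 ((init v)(0 := w, 0 := u))" "t2 \<le> d + 1"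
    using exec_call[of q "(init v)(0 := w)" 0 u d 0] assms(2) by auto
  show ?thesis
    by (rule computesI[OF exec.Seq[OF 1(1) 2(1)]]) (use 1 2 in auto)
qed

lemma computes_then:
  assumes "computes p v w c" and "\<And>s. exec q s 1 (s(0 := f (s 0)))"
  shows "computes (Seq p q) v (f w) (c + 1)"
proof -
  obtain t s where 1: "exec p (init v) t s" "s 0 = w" "t \<le> c"
    using assms(1) unfolding computes_def by blast
  from exec.Seq[OF 1(1) assms(2)] show ?thesis
    unfolding computes_def using 1 by (intro exI[of _ "t + 1"] exI[of _ "s(0 := f (s 0))"]) auto
qed

lemma computes_code: "computes (code e) v (ev e v) (ecost e)"
proof (induction e arbitrary: v)
  case Input
  then show ?case using exec.Copy unfolding computes_def by fastforce
next
  case (Lit k)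
  then show ?case using exec.Const unfolding computes_def by fastforce
next
  case (Hd e)
  then show ?case using computes_then[OF _ exec.Left] by simp
next
  case (Tl e)
  then show ?case using computes_then[OF _ exec.Right] by simp
next
  case (Join e f)
  then show ?case using computes_binary[where f = Cell, OF _ _ exec.MkCell] by simp
next
  case (Plus e f)
  then show ?case using computes_binary[where f = "\<lambda>a b. Num (num a + num b)", OF _ _ exec.Add] by simp
next
  case (Minus e f)
  then show ?case using computes_binary[where f = "\<lambda>a b. Num (num a - num b)", OF _ _ exec.Sub] by simp
next
  case (IfPos g e f)
  show ?case
  proof (cases "num (ev g v) > 0")
    case True
    then show ?thesis
      using computes_mono[OF computes_branch[OF IfPos(1)[of v] IfPos(2)[of v], of "IsPos 1"]] by simp
  next
    case False
    then show ?thesis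
      using computes_mono[OF computes_branch_else[OF IfPos(1)[of v] IfPos(3)[of v], of "IsPos 1"]] by simp
  qed
next
  case (IfCell g e f)
  show ?case
  proof (cases "is_cell (ev g v)")
    case True
    then show ?thesis
      using computes_mono[OF computes_branch[OF IfCell(1)[of v] IfCell(2)[of v], of "IsCell 1"]] by simp
  next
    case False
    then show ?thesis
      using computes_mono[OF computes_branch_else[OF IfCell(1)[of v] IfCell(3)[of v], of "IsCell 1"]] by simp
  qed
next
  case (After f e)
  show ?case using computes_seq[OF After(2)[of v] After(1)] by simp
qed

section \<open>Sequencing, folding, reversing and mapping\<close>

definition seqp :: "prog \<Rightarrow> prog \<Rightarrow> prog" where
  "seqp p q = Seq (Call p 0 0) (Call q 0 0)"

lemma computes_seqp:
  "computes p v w c \<Longrightarrow> computes q w u d \<Longrightarrow> computes (seqp p q) v u (c + d + 2)"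
  unfolding seqp_def by (rule computes_seq)

text \<open>A subroutine sees nothing but its argument. The input is therefore kept and paired with
  the result of \<open>p\<close>, and \<open>f\<close> assembles the next state from this
  pair.\<close>

definition callp :: "expr \<Rightarrow> prog \<Rightarrow> expr \<Rightarrow> prog" where
  "callp e p f =
     seqp (Seq (Call (seqp (code e) p) 1 0) (Seq (Call (code Input) 2 0) (MkCell 0 2 1))) (code f)"

lemma computes_callp:
  assumes "computes p (ev e v) w c"
  shows "computes (callp e p f) v (ev f (Cell v w)) (c + (ecost e + ecost f + 8))"
proof -
  have "exec (MkCell 0 2 1) s 1 (s(0 := (\<lambda>a b. Cell b a) (s 1) (s 2)))" for s
    by (rule exec.MkCell)
  note b = computes_binary[OF computes_seqp[OF computes_code assms] computes_code this]
  show ?thesis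
    unfolding callp_def using computes_mono[OF computes_seqp[OF b[of Input] computes_code]] by simp
qed

text \<open>Cell 1 holds the unread part of the list, cell 0 the accumulator, and cell 2 the pair of
  the current element and the accumulator that is handed to \<open>p\<close>.\<close>

definition foldp :: "prog \<Rightarrow> prog" where
  "foldp p = Seq (Left 1 0) (Seq (Right 0 0) (While (IsCell 1)
     (Seq (Left 2 1) (Seq (MkCell 2 2 0) (Seq (Call p 0 2) (Right 1 1))))))"

lemma computes_foldp:
  fixes h :: "'s \<Rightarrow> val"
  assumes "\<And>x r. x \<in> set xs \<Longrightarrow> computes p (Cell (g x) (h r)) (h (F x r)) (c x)"
  shows "computes (foldp p) (Cell (vlist g xs) (h r)) (h (fold F xs r)) ((\<Sum>x\<leftarrow>xs. c x + 5) + 3)"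
proof -
  let ?b = "Seq (Left 2 1) (Seq (MkCell 2 2 0) (Seq (Call p 0 2) (Right 1 1)))"
  have loop: "\<exists>t s'. exec (While (IsCell 1) ?b) s t s' \<and> s' 0 = h (fold F xs r) \<and>
      t \<le> (\<Sum>x\<leftarrow>xs. c x + 5) + 1"
    if "s 1 = vlist g xs" "s 0 = h r" for s :: memory and r
    using assms that
  proof (induction xs arbitrary: r s)
    case Nil
    then have "exec (While (IsCell 1) ?b) s 1 s" by (intro exec.WhileFalse) simp
    then show ?case using Nil by (intro exI[of _ 1] exI[of _ s]) simp
  next
    case (Cons x xs)
    let ?s = "s(2 := g x, 2 := Cell (g x) (h r))"
    obtain t where t: "exec (Call p 0 2) ?s t (?s(0 := h (F x r)))" "t \<le> c x + 1"
      using exec_call[of p ?s 2 "h (F x r)" "c x" 0] Cons.prems by auto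
    let ?s' = "?s(0 := h (F x r), 1 := vlist g xs)"
    have 1: "exec (Left 2 1) s 1 (s(2 := g x))"
      using exec.Left[of 2 1 s] Cons.prems by simp
    have 2: "exec (MkCell 2 2 0) (s(2 := g x)) 1 ?s"
      using exec.MkCell[of 2 2 0 "s(2 := g x)"] Cons.prems by simp
    have 3: "exec (Right 1 1) (?s(0 := h (F x r))) 1 ?s'"
      using exec.Right[of 1 1 "?s(0 := h (F x r))"] Cons.prems by simp
    have b: "exec ?b s (1 + (1 + (t + 1))) ?s'"
      by (rule exec.Seq[OF 1 exec.Seq[OF 2 exec.Seq[OF t(1) 3]]])
    have "?s' 1 = vlist g xs" "?s' 0 = h (F x r)" by simp_all
    from Cons.IH[OF Cons.prems(1) this] obtain t' s' where
      r: "exec (While (IsCell 1) ?b) ?s' t' s'" "s' 0 = h (fold F xs (F x r))"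
        "t' \<le> (\<Sum>x\<leftarrow>xs. c x + 5) + 1"
      by (auto simp del: fun_upd_apply)
    have "holds (IsCell 1) s" using Cons.prems by simp
    \<comment> \<open>The guard, three instructions and the overhead of the call give the constant
      5.\<close>
    from exec.WhileTrue[OF this b r(1)] show ?case
      using r t by (intro exI[of _ "1 + (1 + (1 + (t + 1))) + t'"] exI[of _ s']) auto
  qed
  let ?s0 = "init (Cell (vlist g xs) (h r))"
  let ?s1 = "?s0(1 := vlist g xs)"
  let ?s2 = "?s1(0 := h r)"
  have 1: "exec (Left 1 0) ?s0 1 ?s1" using exec.Left[of 1 0 ?s0] by simp
  have 2: "exec (Right 0 0) ?s1 1 ?s2" using exec.Right[of 0 0 ?s1] by simp
  obtain t s' where l: "exec (While (IsCell 1) ?b) ?s2 t s'" "s' 0 = h (fold F xs r)"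
      "t \<le> (\<Sum>x\<leftarrow>xs. c x + 5) + 1"
    using loop[of ?s2 r] by auto
  show ?thesis
    unfolding foldp_def by (rule computesI[OF exec.Seq[OF 1 exec.Seq[OF 2 l(1)]]]) (use l in auto)
qed

lemma computes_foldp_code:
  "computes (foldp (code e)) (Cell (vlist g xs) v) (fold (\<lambda>x r. ev e (Cell (g x) r)) xs v)
     ((ecost e + 5) * length xs + 3)"
  using computes_foldp[of xs "code e" g "\<lambda>r. r" "\<lambda>x r. ev e (Cell (g x) r)" "\<lambda>_. ecost e" v]
  by (simp add: computes_code sum_list_triv mult.commute)

text \<open>The pair of an element and the accumulator already encodes the longer list, so the loop
  body is the identity.\<close>

definition revp :: prog where
  "revp = foldp (code Input)"

lemma computes_revp:
  "computes revp (Cell (vlist g xs) (vlist g ys)) (vlist g (rev xs @ ys)) (6 * length xs + 3)"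
proof -
  have "fold (\<lambda>x. Cell (g x)) xs (vlist g ys) = vlist g (rev xs @ ys)"
    by (induction xs arbitrary: ys) (simp_all, metis append_Cons append_Nil vlist.simps(2))
  then show ?thesis
    using computes_foldp_code[of Input g xs "vlist g ys"] unfolding revp_def by simp
qed

text \<open>The accumulator carries the fixed parameter along with the output, because
  \<open>p\<close> receives it at every element. The output arises back to front, hence the final
  \<open>revp\<close>.\<close>

definition mapp :: "prog \<Rightarrow> prog" where
  "mapp p = seqp
     (callp (Join (Hd Input) (Join (Tl Input) (Lit 0)))
        (foldp (callp (Join (Hd Input) (Hd (Tl Input))) p
           (Join (Hd (Tl (Hd Input))) (Join (Tl Input) (Tl (Tl (Hd Input)))))))
        (Join (Tl (Tl Input)) (Lit 0)))
     revp"

lemma computes_mapp: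
  assumes "\<And>x. x \<in> set xs \<Longrightarrow> computes p (Cell (g x) v) (h (f x)) (c x)"
  shows "computes (mapp p) (Cell (vlist g xs) v) (vlist h (map f xs)) ((\<Sum>x\<leftarrow>xs. c x + 60) + 80)"
proof -
  let ?e = "Join (Hd Input) (Hd (Tl Input))"
  let ?f = "Join (Hd (Tl (Hd Input))) (Join (Tl Input) (Tl (Tl (Hd Input))))"
  have "computes (callp ?e p ?f) (Cell (g x) (Cell v (vlist h r))) (Cell v (vlist h (f x # r)))
      (c x + 35)" if "x \<in> set xs" for x r
    using computes_callp[of p ?e "Cell (g x) (Cell v (vlist h r))" "h (f x)" "c x" ?f] assms[OF that]
    by (auto intro: computes_mono)
  note fold = computes_foldp[of xs _ g "\<lambda>r. Cell v (vlist h r)" "\<lambda>x r. f x # r", OF this]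
  have "fold (\<lambda>x. (#) (f x)) xs r = rev (map f xs) @ r" for r
    by (induction xs arbitrary: r) simp_all
  then have 1: "computes (foldp (callp ?e p ?f)) (Cell (vlist g xs) (Cell v (Num 0)))
     (Cell v (vlist h (rev (map f xs)))) ((\<Sum>x\<leftarrow>xs. c x + 35 + 5) + 3)"
    using fold[of "[]"] by simp
  have 2: "computes (callp (Join (Hd Input) (Join (Tl Input) (Lit 0))) (foldp (callp ?e p ?f))
        (Join (Tl (Tl Input)) (Lit 0))) (Cell (vlist g xs) v)
      (Cell (vlist h (rev (map f xs))) (Num 0)) ((\<Sum>x\<leftarrow>xs. c x + 35 + 5) + 60)"
    using computes_callp[of "foldp (callp ?e p ?f)" "Join (Hd Input) (Join (Tl Input) (Lit 0))"
        "Cell (vlist g xs) v" "Cell v (vlist h (rev (map f xs)))" "(\<Sum>x\<leftarrow>xs. c x + 35 + 5) + 3"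
        "Join (Tl (Tl Input)) (Lit 0)"] 1
    by (auto elim: computes_mono)
  \<comment> \<open>The reversal costs 6 per element, which the slack between 40 and 60
    absorbs.\<close>
  have 3: "(\<Sum>x\<leftarrow>xs. c x + 40) + 6 * length xs \<le> (\<Sum>x\<leftarrow>xs. c x + 60)"
    by (induction xs) auto
  show ?thesis
    unfolding mapp_def
    using computes_mono[OF computes_seqp[OF 2 computes_revp[of h "rev (map f xs)" "[]", simplified]],
      of "(\<Sum>x\<leftarrow>xs. c x + 60) + 80"] 3 by (simp add: add.commute)
qed

section \<open>Matchings and edit distance\<close>

text \<open>The equivalence forces a strictly increasing partial bijection: pairs that share a
  coordinate are equal.\<close>

definition noncrossing :: "(nat \<times> nat) set \<Rightarrow> bool" where
  "noncrossing M \<longleftrightarrow> (\<forall>i j i' j'. (i, j) \<in> M \<longrightarrow> (i', j') \<in> M \<longrightarrow> (i < i' \<longleftrightarrow> j < j'))"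

definition matching :: "'a list \<Rightarrow> 'a list \<Rightarrow> (nat \<times> nat) set \<Rightarrow> bool" where
  "matching x y M \<longleftrightarrow>
     noncrossing M \<and> (\<forall>(i, j)\<in>M. i < length x \<and> j < length y \<and> x ! i = y ! j)"

lemma noncrossing_subset: "noncrossing M \<Longrightarrow> M' \<subseteq> M \<Longrightarrow> noncrossing M'"
  unfolding noncrossing_def by blast

lemma noncrossing_fst_inj: "noncrossing M \<Longrightarrow> (i, j) \<in> M \<Longrightarrow> (i, j') \<in> M \<Longrightarrow> j = j'"
  unfolding noncrossing_def by (metis linorder_neqE_nat less_irrefl)

lemma noncrossing_snd_inj: "noncrossing M \<Longrightarrow> (i, j) \<in> M \<Longrightarrow> (i', j) \<in> M \<Longrightarrow> i = i'"
  unfolding noncrossing_def by (metis linorder_neqE_nat less_irrefl)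

lemma inj_on_fst: "noncrossing M \<Longrightarrow> inj_on fst M"
  by (auto simp: inj_on_def dest: noncrossing_fst_inj)

lemma inj_on_snd: "noncrossing M \<Longrightarrow> inj_on snd M"
  by (auto simp: inj_on_def dest: noncrossing_snd_inj)

lemma matching_finite: "matching x y M \<Longrightarrow> finite M"
  by (rule finite_subset[of _ "{..<length x} \<times> {..<length y}"]) (auto simp: matching_def)

lemma matching_converse: "matching x y M \<Longrightarrow> matching y x (M\<inverse>)"
  unfolding matching_def noncrossing_def by fastforce

section \<open>Matchings versus sequences of insertions and deletions\<close>

lemma indel_append_left: "indel x d i y \<Longrightarrow> indel (w @ x) d i (w @ y)"
proof (induction rule: indel.induct)
  case refl
  show ?case by (rule indel.refl)
next
  case (delete d i u a v)
  then show ?case using indel.delete[of "w @ x" d i "w @ u" a v] by simp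
next
  case (insert d i u v a)
  then show ?case using indel.insert[of "w @ x" d i "w @ u" v a] by simp
qed

lemma indel_append_right: "indel x d i y \<Longrightarrow> indel (x @ w) d i (y @ w)"
proof (induction rule: indel.induct)
  case refl
  show ?case by (rule indel.refl)
next
  case (delete d i u a v)
  then show ?case using indel.delete[of "x @ w" d i u a "v @ w"] by simp
next
  case (insert d i u v a)
  then show ?case using indel.insert[of "x @ w" d i u "v @ w" a] by simp
qed

lemma indel_trans: "indel y d' i' z \<Longrightarrow> indel x d i y \<Longrightarrow> indel x (d + d') (i + i') z"
proof (induction rule: indel.induct)
  case refl
  then show ?case by simp
next
  case (delete d' i' u a v)
  then show ?case using indel.delete[of x "d + d'" "i + i'" u a v] by simp
next
  case (insert d' i' u v a)
  then show ?case using indel.insert[of x "d + d'" "i + i'" u v a] by simp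
qed

lemma indel_append: "indel x d i y \<Longrightarrow> indel x' d' i' y' \<Longrightarrow> indel (x @ x') (d + d') (i + i') (y @ y')"
  by (rule indel_trans[OF indel_append_left indel_append_right])

lemma indel_replace: "indel x (length x) (length y) y"
proof -
  have "indel x (length x) 0 []"
  proof (induction x)
    case (Cons a x)
    then have "indel (a # x) (length x) 0 [a]"
      using indel_append_left[of x "length x" 0 "[]" "[a]"] by simp
    then show ?case using indel.delete[of "a # x" _ _ "[]" a "[]"] by simp
  qed (auto intro: indel.refl)
  moreover have "indel [] 0 (length y) y"
  proof (induction y)
    case (Cons a y)
    then show ?case using indel.insert[of "[]" _ _ "[]" y a] by simp
  qed (auto intro: indel.refl)
  ultimately show ?thesis using indel_trans[of "[]" 0 "length y" y x "length x" 0] by simp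
qed

text \<open>Induction on the size of the matching, splitting off its last pair: the prefixes before
  it are covered by the induction hypothesis, its symbol is kept, and the suffixes after it are
  deleted and inserted as a whole. Each unmatched symbol costs one operation, which gives the
  equation.\<close>

lemma matching_indel:
  "matching x y M \<Longrightarrow>
     \<exists>d i. indel x d i y \<and> d + i + 2 * card M = length x + length y"
proof (induction "card M" arbitrary: x y M)
  case 0
  then have "M = {}" using matching_finite[of x y M] by simp
  then show ?case using indel_replace[of x y] by auto
next
  case (Suc k)
  have fin: "finite M" using Suc.prems matching_finite by blast
  then have "fst ` M \<noteq> {}" using Suc.hyps(2) by auto
  then obtain i j where ij: "(i, j) \<in> M" "i = Max (fst ` M)"
    using Max_in[of "fst ` M"] fin by fastforce
  define N where "N = M - {(i, j)}"
  have nc: "noncrossing M" and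
    M: "\<And>i j. (i, j) \<in> M \<Longrightarrow> i < length x \<and> j < length y \<and> x ! i = y ! j"
    using Suc.prems by (auto simp: matching_def)
  have max: "i' < i \<and> j' < j" if "(i', j') \<in> N" for i' j'
  proof -
    have "i' \<le> i" using that ij fin unfolding N_def by (auto intro!: Max_ge intro: rev_image_eqI)
    moreover have "i' \<noteq> i" using that ij nc noncrossing_fst_inj[of M i j j'] by (auto simp: N_def)
    ultimately have "i' < i" by simp
    with nc ij that show ?thesis unfolding noncrossing_def N_def by auto
  qed
  have "matching (take i x) (take j y) N"
    using max M noncrossing_subset[OF nc] by (fastforce simp: matching_def N_def)
  moreover have "k = card N" using Suc.hyps(2) ij fin by (simp add: N_def)
  ultimately obtain d e where *: "indel (take i x) d e (take j y)"
      "d + e + 2 * k = min (length x) i + min (length y) j"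
    using Suc.hyps(1)[of N "take i x" "take j y"] by auto
  have lt: "i < length x" "j < length y" "x ! i = y ! j" using M[OF ij(1)] by auto
  have "indel (take i x @ [x ! i] @ drop (Suc i) x)
     (d + (length (drop (Suc i) x))) (e + (length (drop (Suc j) y))) (take j y @ [x ! i] @ drop (Suc j) y)"
    by (intro indel_append indel_append_left * indel_replace)
  then have "indel x (d + (length x - Suc i)) (e + (length y - Suc j)) y"
    using lt id_take_nth_drop[of i x] id_take_nth_drop[of j y] by simp
  moreover have "d + (length x - Suc i) + (e + (length y - Suc j)) + 2 * card M = length x + length y"
    using *(2) lt Suc.hyps(2) by simp
  ultimately show ?case by blast
qed

lemma matching_ED:
  assumes "matching x y M"
  shows "ED x y + 2 * card M \<le> length x + length y"
proof -
  obtain d i where "indel x d i y" "d + i + 2 * card M = length x + length y"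
    using matching_indel[OF assms] by blast
  moreover from this have "ED x y \<le> d + i" unfolding ED_def by (intro Least_le) blast
  ultimately show ?thesis by simp
qed

text \<open>Serves to shift positions after an insertion or deletion, and to pass from positions in
  the received word to positions in what remains of it.\<close>

lemma matching_reindex:
  assumes "matching x y M" and "\<And>j j'. j \<in> snd ` M \<Longrightarrow> j' \<in> snd ` M \<Longrightarrow> f j < f j' \<longleftrightarrow> j < j'"
    and "\<And>j. j \<in> snd ` M \<Longrightarrow> f j < length y' \<and> y' ! f j = y ! j"
  shows "matching x y' (map_prod id f ` M)" "card (map_prod id f ` M) = card M"
proof -
  have *: "\<And>i j i' j'. (i, j) \<in> M \<Longrightarrow> (i', j') \<in> M \<Longrightarrow> f j < f j' \<longleftrightarrow> j < j'"
    using assms(2) by force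
  have **: "\<And>i j. (i, j) \<in> M \<Longrightarrow> f j < length y' \<and> y' ! f j = y ! j"
    using assms(3) by force
  show "matching x y' (map_prod id f ` M)"
    using assms(1) * ** by (auto simp: matching_def noncrossing_def) 
  have "inj_on (map_prod id f) M"
    using noncrossing_fst_inj assms(1) by (force simp: inj_on_def matching_def)
  then show "card (map_prod id f ` M) = card M" by (rule card_image)
qed

text \<open>Original symbols that are still present are matched to their current positions. A
  deletion destroys at most one pair, an insertion none, and both shift the later positions by
  one.\<close>

lemma indel_matching:
  "indel x d i y \<Longrightarrow>
     \<exists>M. matching x y M \<and> length x \<le> card M + d \<and> length y + d = length x + i"
proof (induction rule: indel.induct)
  case refl
  have "matching x x ((\<lambda>i. (i, i)) ` {..<length x})" by (auto simp: matching_def noncrossing_def)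
  moreover have "card ((\<lambda>i. (i, i)) ` {..<length x}) = length x"
    by (subst card_image) (auto simp: inj_on_def)
  ultimately show ?case
    by (intro exI[of _ "(\<lambda>i. (i, i)) ` {..<length x}"]) simp
next
  case (delete d i u a v)
  then obtain M where M: "matching x (u @ a # v) M" "length x \<le> card M + d"
    "length (u @ a # v) + d = length x + i" by blast
  define N where "N = {p \<in> M. snd p \<noteq> length u}"
  \<comment> \<open>Positions behind the deleted one move down; the deleted position
    \<open>length u\<close> itself does not occur in \<open>N\<close>.\<close>
  define f where "f j = (if j < length u then j else j - 1)" for j
  have N: "matching x (u @ a # v) N"
    using M(1) noncrossing_subset[of M N] unfolding matching_def N_def by auto
  have "M - N \<subseteq> {p \<in> M. snd p = length u}" by (auto simp: N_def)
  moreover have "finite {p \<in> M. snd p = length u}" using matching_finite[OF M(1)] by simp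
  moreover have "card {p \<in> M. snd p = length u} \<le> Suc 0"
    using M(1) by (subst card_le_Suc0_iff_eq) (use matching_finite[OF M(1)] in
      \<open>auto simp: matching_def dest: noncrossing_snd_inj\<close>)
  ultimately have "card (M - N) \<le> 1" using card_mono le_trans One_nat_def by metis
  then have c: "card M \<le> card N + 1"
    using card_Diff_subset[of N M] matching_finite[OF N] by (auto simp: N_def)
  have ne: "j \<noteq> length u" "j < Suc (length u + length v)" if "j \<in> snd ` N" for j
    using that N by (auto simp: N_def matching_def)
  have "f j < f j' \<longleftrightarrow> j < j'" if "j \<in> snd ` N" "j' \<in> snd ` N" for j j'
    using ne[OF that(1)] ne[OF that(2)] by (auto simp: f_def)
  moreover have "f j < length (u @ v) \<and> (u @ v) ! f j = (u @ a # v) ! j" if "j \<in> snd ` N" for j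
    using ne[OF that] by (auto simp: f_def nth_append nth_Cons')
  ultimately have "matching x (u @ v) (map_prod id f ` N)" "card (map_prod id f ` N) = card N"
    using matching_reindex[OF N, of f "u @ v"] by blast+
  moreover have "length x \<le> card N + Suc d" "length (u @ v) + Suc d = length x + i"
    using M c by auto
  ultimately show ?case by metis
next
  case (insert d i u v a)
  then obtain M where M: "matching x (u @ v) M" "length x \<le> card M + d"
    "length (u @ v) + d = length x + i" by blast
  define f where "f j = (if j < length u then j else j + 1)" for j
  have lt: "j < length u + length v" if "j \<in> snd ` M" for j
    using that M(1) by (auto simp: matching_def)
  have "f j < f j' \<longleftrightarrow> j < j'" if "j \<in> snd ` M" "j' \<in> snd ` M" for j j'
    using lt[OF that(1)] lt[OF that(2)] by (auto simp: f_def)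
  moreover have "f j < length (u @ a # v) \<and> (u @ a # v) ! f j = (u @ v) ! j" if "j \<in> snd ` M" for j
    using lt[OF that] by (auto simp: f_def nth_append nth_Cons')
  ultimately have "matching x (u @ a # v) (map_prod id f ` M)" "card (map_prod id f ` M) = card M"
    using matching_reindex[OF M(1), of f "u @ a # v"] by blast+
  moreover have "length (u @ a # v) + d = length x + Suc i" using M by simp
  ultimately show ?case using M(2) by metis
qed

section \<open>Self-matchings and single rounds\<close>

text \<open>If \<open>(i\<^sub>0, j\<^sub>0)\<close> is the first pair of \<open>M\<close>, the pairs \<open>(i, j)\<close> with \<open>i < j\<^sub>0\<close> match the slices
  \<open>[i\<^sub>0, j\<^sub>0)\<close> and \<open>[j\<^sub>0, q)\<close>, and \<open>N\<close> consists of the other pairs.\<close>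

lemma synchronization_string_group:
  assumes sync: "synchronization_string \<epsilon> T" and M: "matching T T M"
    and mem: "(i\<^sub>0, j\<^sub>0) \<in> M" and low: "\<And>i j. (i, j) \<in> M \<Longrightarrow> i\<^sub>0 \<le> i \<and> j\<^sub>0 \<le> j"
    and less: "i\<^sub>0 < j\<^sub>0"
  obtains N p q where "N \<subset> M" "\<And>i j. (i, j) \<in> N \<Longrightarrow> p \<le> i \<and> q \<le> j"
    "p \<le> length T" "q \<le> length T"
    "2 * real (card M) \<le> 2 * real (card N) + \<epsilon> * ((real p - real i\<^sub>0) + (real q - real j\<^sub>0))"
proof -
  define M1 where "M1 = {(i, j) \<in> M. i < j\<^sub>0}"
  define N where "N = M - M1"
  define q where "q = Suc (Max (snd ` M1))"
  have nc: "noncrossing M" and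
    inM: "\<And>i j. (i, j) \<in> M \<Longrightarrow> i < length T \<and> j < length T \<and> T ! i = T ! j"
    using M by (auto simp: matching_def)
  have fin: "finite M" using M matching_finite by blast
  have mem1: "(i\<^sub>0, j\<^sub>0) \<in> M1" using mem less by (simp add: M1_def)
  have sub: "M1 \<subseteq> M" by (auto simp: M1_def)
  then have fin1: "finite M1" using fin finite_subset by blast
  have "Max (snd ` M1) \<in> snd ` M1" using fin1 mem1 by (intro Max_in) auto
  then obtain i\<^sub>1 j\<^sub>1 where ij1: "(i\<^sub>1, j\<^sub>1) \<in> M1" "q = Suc j\<^sub>1" unfolding q_def by force
  have ltq: "j < q" if "(i, j) \<in> M1" for i j
    using that fin1 unfolding q_def by (auto intro!: Max_ge simp: less_Suc_eq_le intro: rev_image_eqI)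
  have qT: "q \<le> length T" using inM ij1 sub by force
  have "j\<^sub>0 < q" using ltq mem1 by blast
  let ?M1 = "map_prod (\<lambda>i. i - i\<^sub>0) (\<lambda>j. j - j\<^sub>0) ` M1"
  have in1: "i\<^sub>0 \<le> i \<and> i < j\<^sub>0 \<and> j\<^sub>0 \<le> j \<and> j < q \<and> T ! i = T ! j" if "(i, j) \<in> M1" for i j
    using that low inM ltq by (auto simp: M1_def)
  have inj: "inj_on (map_prod (\<lambda>i. i - i\<^sub>0) (\<lambda>j. j - j\<^sub>0)) M1"
  proof (rule inj_onI, clarsimp)
    fix a b a' b' assume "(a, b) \<in> M1" "(a', b') \<in> M1" "a - i\<^sub>0 = a' - i\<^sub>0" "b - j\<^sub>0 = b' - j\<^sub>0"
    then show "a = a' \<and> b = b'" using in1[of a b] in1[of a' b'] by linarith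
  qed
  have "noncrossing ?M1"
    unfolding noncrossing_def
  proof (intro allI impI)
    fix i j i' j' assume "(i, j) \<in> ?M1" "(i', j') \<in> ?M1"
    then obtain a b a' b' where *: "(a, b) \<in> M1" "(a', b') \<in> M1"
      "i = a - i\<^sub>0" "j = b - j\<^sub>0" "i' = a' - i\<^sub>0" "j' = b' - j\<^sub>0" by auto
    moreover have "a < a' \<longleftrightarrow> b < b'" using nc * sub unfolding noncrossing_def by blast
    ultimately show "i < i' \<longleftrightarrow> j < j'" using in1[of a b] in1[of a' b'] by auto
  qed
  then have "matching (slice i\<^sub>0 j\<^sub>0 T) (slice j\<^sub>0 q T) ?M1"
    using in1 qT less by (fastforce simp: matching_def slice_def)
  \<comment> \<open>Many pairs between adjacent slices make their edit distance small, whereas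
    synchronization makes it large; comparing the two bounds \<open>card M1\<close>.\<close>
  from matching_ED[OF this] have "ED (slice i\<^sub>0 j\<^sub>0 T) (slice j\<^sub>0 q T) + 2 * card M1 \<le> q - i\<^sub>0"
    using card_image[OF inj] qT less \<open>j\<^sub>0 < q\<close> by (simp add: slice_def)
  then have "real (ED (slice i\<^sub>0 j\<^sub>0 T) (slice j\<^sub>0 q T)) + 2 * real (card M1) \<le> real (q - i\<^sub>0)"
    by linarith
  moreover have "(1 - \<epsilon>) * real (q - i\<^sub>0) < real (ED (slice i\<^sub>0 j\<^sub>0 T) (slice j\<^sub>0 q T))"
    using sync less \<open>j\<^sub>0 < q\<close> qT unfolding synchronization_string_def by blast
  moreover have "real (q - i\<^sub>0) = real q - real i\<^sub>0" using less \<open>j\<^sub>0 < q\<close> by simp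
  ultimately have "2 * real (card M1) \<le> \<epsilon> * (real q - real i\<^sub>0)" by (simp add: algebra_simps)
  moreover have "card M = card N + card M1"
    using sub fin card_Diff_subset[OF fin1 sub] card_mono[OF fin sub] by (simp add: N_def)
  \<comment> \<open>The length \<open>q - i\<^sub>0\<close> is written as the sum of the advances of
    the two coordinates, which telescopes when groups are removed repeatedly.\<close>
  ultimately have "2 * real (card M) \<le> 2 * real (card N) + \<epsilon> * ((real j\<^sub>0 - real i\<^sub>0) + (real q - real j\<^sub>0))"
    by simp
  moreover have "j\<^sub>0 \<le> i \<and> q \<le> j" if "(i, j) \<in> N" for i j
  proof -
    have "j\<^sub>0 \<le> i" "(i, j) \<in> M" using that by (auto simp: N_def M1_def)
    moreover have "i\<^sub>1 < j\<^sub>0" using ij1 by (simp add: M1_def)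
    \<comment> \<open>A pair outside \<open>M1\<close> lies behind the last pair of
      \<open>M1\<close> in the first coordinate, hence also in the second.\<close>
    ultimately have "j\<^sub>1 < j" using nc ij1 sub unfolding noncrossing_def
      by (meson in_mono less_le_trans)
    with \<open>j\<^sub>0 \<le> i\<close> ij1 show ?thesis by simp
  qed
  moreover have "N \<subset> M" using mem1 sub by (auto simp: N_def)
  moreover have "j\<^sub>0 \<le> length T" using inM[OF mem] by simp
  ultimately show ?thesis using that qT by blast
qed

text \<open>Groups are removed one after another. Each has at most \<epsilon>/2 times as many pairs
  as the lower bounds of the two coordinates advance, and together these bounds advance by at most
  \<open>2 * length T\<close>.\<close>

lemma synchronization_string_self_matching:
  assumes sync: "synchronization_string \<epsilon> T" and "\<epsilon> \<ge> 0"
    and "matching T T M" and "\<And>i j. (i, j) \<in> M \<Longrightarrow> i \<noteq> j"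
  shows "real (card M) \<le> \<epsilon> * real (length T)"
proof -
  \<comment> \<open>Strengthened for the induction: the pairs lie beyond \<open>p\<close> and
    \<open>q\<close>, and the distances from there to the end of the string serve as a
    potential.\<close>
  have "2 * real (card M) \<le> \<epsilon> * ((real (length T) - real p) + (real (length T) - real q))"
    if "matching T T M" "\<And>i j. (i, j) \<in> M \<Longrightarrow> i \<noteq> j \<and> p \<le> i \<and> q \<le> j"
      "p \<le> length T" "q \<le> length T" for M p q
    using that
  proof (induction "card M" arbitrary: M p q rule: less_induct)
    case less
    show ?case
    proof (cases "M = {}")
      case True
      with less.prems \<open>\<epsilon> \<ge> 0\<close> show ?thesis by simp
    next
      case False
      have nc: "noncrossing M" using less.prems(1) by (simp add: matching_def)
      have fin: "finite M" using less.prems(1) matching_finite by blast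
      with False have "Min (fst ` M) \<in> fst ` M" by (intro Min_in) auto
      then obtain i\<^sub>0 j\<^sub>0 where mem: "(i\<^sub>0, j\<^sub>0) \<in> M" "i\<^sub>0 = Min (fst ` M)" by force
      have low: "i\<^sub>0 \<le> i \<and> j\<^sub>0 \<le> j" if "(i, j) \<in> M" for i j
      proof -
        have "i\<^sub>0 \<le> i" using that fin unfolding mem(2) by (auto intro!: Min_le intro: rev_image_eqI)
        with nc mem that show ?thesis unfolding noncrossing_def by (meson not_less)
      qed
      have "\<exists>N p' q'. N \<subset> M \<and> (\<forall>i j. (i, j) \<in> N \<longrightarrow> p' \<le> i \<and> q' \<le> j) \<and>
          p' \<le> length T \<and> q' \<le> length T \<and>
          2 * real (card M) \<le> 2 * real (card N) + \<epsilon> * ((real p' - real i\<^sub>0) + (real q' - real j\<^sub>0))"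
      proof (cases "i\<^sub>0 < j\<^sub>0")
        case True
        obtain N p' q' where "N \<subset> M" "\<And>i j. (i, j) \<in> N \<Longrightarrow> p' \<le> i \<and> q' \<le> j"
          "p' \<le> length T" "q' \<le> length T"
          "2 * real (card M) \<le> 2 * real (card N) + \<epsilon> * ((real p' - real i\<^sub>0) + (real q' - real j\<^sub>0))"
          using synchronization_string_group[OF sync less.prems(1) mem(1) low True] by metis
        then show ?thesis by blast
      next
        case False
        \<comment> \<open>The mirror case: the group is removed from the converse matching and the
          rest is turned back, which exchanges the two bounds.\<close>
        then have "j\<^sub>0 < i\<^sub>0" using less.prems(2)[OF mem(1)] by simp
        moreover have "(j\<^sub>0, i\<^sub>0) \<in> M\<inverse>" "\<And>i j. (i, j) \<in> M\<inverse> \<Longrightarrow> j\<^sub>0 \<le> i \<and> i\<^sub>0 \<le> j"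
          using mem low by auto
        ultimately obtain N p' q' where N: "N \<subset> M\<inverse>" "\<And>i j. (i, j) \<in> N \<Longrightarrow> p' \<le> i \<and> q' \<le> j"
          "p' \<le> length T" "q' \<le> length T"
          "2 * real (card (M\<inverse>)) \<le> 2 * real (card N) + \<epsilon> * ((real p' - real j\<^sub>0) + (real q' - real i\<^sub>0))"
          using synchronization_string_group[OF sync matching_converse[OF less.prems(1)]] by metis
        then show ?thesis
          by (intro exI[of _ "N\<inverse>"] exI[of _ q'] exI[of _ p']) (auto simp: add.commute)
      qed
      then obtain N p' q' where N: "N \<subset> M" "\<And>i j. (i, j) \<in> N \<Longrightarrow> p' \<le> i \<and> q' \<le> j"
          "p' \<le> length T" "q' \<le> length T"
          "2 * real (card M) \<le> 2 * real (card N) + \<epsilon> * ((real p' - real i\<^sub>0) + (real q' - real j\<^sub>0))"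
        by blast
      have "card N < card M" using N(1) fin by (rule psubset_card_mono[rotated])
      moreover have "matching T T N"
        using less.prems(1) N(1) noncrossing_subset[of M N] by (auto simp: matching_def)
      ultimately have "2 * real (card N) \<le> \<epsilon> * ((real (length T) - real p') + (real (length T) - real q'))"
        using less.prems(2) N(1-4) by (intro less.hyps) (blast+)
      with N(5) have "2 * real (card M) \<le> \<epsilon> * ((real (length T) - real i\<^sub>0) + (real (length T) - real j\<^sub>0))"
        by (simp add: algebra_simps)
      also have "\<dots> \<le> \<epsilon> * ((real (length T) - real p) + (real (length T) - real q))"
        using less.prems(2)[OF mem(1)] \<open>\<epsilon> \<ge> 0\<close> by (intro mult_left_mono) auto
      finally show ?thesis .
    qed
  qed
  from this[of M 0 0] assms(3,4) show ?thesis by simp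
qed

section \<open>Matchings, leftovers and symbol lists read off an edit script\<close>

text \<open>\<open>k\<close> counts positions of the first string, while symbols of the second carry
  labels from \<open>J\<close>, meant to be their positions in the original received word.\<close>

fun matched :: "'a edit list \<Rightarrow> nat \<Rightarrow> 'b list \<Rightarrow> (nat \<times> 'b) set" where
  "matched (Keep # es) k (j # J) = insert (k, j) (matched es (Suc k) J)"
| "matched (Delete # es) k J = matched es (Suc k) J"
| "matched (Insert a # es) k (j # J) = matched es k J"
| "matched _ _ _ = {}"

text \<open>For a script that turns the index string into the remaining word, the inserted symbols
  are those that stay unmatched.\<close>

fun leftover :: "'a edit list \<Rightarrow> 'b list \<Rightarrow> 'b list" where
  "leftover (Keep # es) (j # J) = leftover es J"
| "leftover (Delete # es) J = leftover es J"
| "leftover (Insert a # es) (j # J) = j # leftover es J"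
| "leftover _ _ = []"

text \<open>\<open>List.insert\<close> keeps the lists free of duplicates, as
  \<open>recovers_within\<close> demands of its input.\<close>

fun collect :: "'a edit list \<Rightarrow> 'b list \<Rightarrow> 'b list list \<Rightarrow> 'b list list" where
  "collect (Keep # es) (b # y) (S # Ss) = List.insert b S # collect es y Ss"
| "collect (Delete # es) y (S # Ss) = S # collect es y Ss"
| "collect (Insert a # es) (b # y) Ss = collect es y Ss"
| "collect _ _ _ = []"

lemma edits_length: "edits es x y \<Longrightarrow> length es \<le> length x + length y"
  by (induction rule: edits.induct) auto

lemma leftover_map: "leftover es (map f J) = map f (leftover es J)"
  by (induction es J rule: leftover.induct) auto

lemma matched_bounds:
  "edits es W V \<Longrightarrow> V = map f J \<Longrightarrow> (i, j) \<in> matched es k J \<Longrightarrow>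
     k \<le> i \<and> i < k + length W \<and> j \<in> set J \<and> W ! (i - k) = f j"
proof (induction arbitrary: J k rule: edits.induct)
  case (2 es x y a)
  then obtain j' J' where J: "J = j' # J'" "a = f j'" "y = map f J'" by auto
  show ?case
  proof (cases "i = k \<and> j = j'")
    case False
    then have "(i, j) \<in> matched es (Suc k) J'" using 2 J by auto
    from 2(2)[OF J(3) this] show ?thesis using J by (auto simp: nth_Cons')
  qed (use J in auto)
next
  case (3 es x y a)
  then have "(i, j) \<in> matched es (Suc k) J" by simp
  from 3(2)[OF 3(3) this] show ?case by (auto simp: nth_Cons')
next
  case (4 es x y a)
  then obtain j' J' where J: "J = j' # J'" "y = map f J'" by auto
  then have "(i, j) \<in> matched es k J'" using 4 by auto
  from 4(2)[OF J(2) this] show ?case using J by auto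
qed simp

text \<open>Symbols of the first string are kept or deleted and those of the second kept or
  inserted, which gives the counts; increasing labels make the pairs noncrossing.\<close>

lemma matched_card:
  fixes J :: "nat list"
  shows "edits es W V \<Longrightarrow> V = map f J \<Longrightarrow> sorted_wrt (<) J \<Longrightarrow>
    noncrossing (matched es k J) \<and> finite (matched es k J) \<and>
    card (matched es k J) + length (leftover es J) = length J \<and>
    num_edits es + 2 * card (matched es k J) = length W + length J \<and>
    set (leftover es J) \<union> snd ` matched es k J = set J \<and>
    set (leftover es J) \<inter> snd ` matched es k J = {} \<and>
    sorted_wrt (<) (leftover es J)"
proof (induction arbitrary: J k rule: edits.induct)
  case 1
  then show ?case by (auto simp: noncrossing_def num_edits_def)
next
  case (2 es x y a)
  then obtain j' J' where J: "J = j' # J'" "a = f j'" "y = map f J'" by auto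
  have b: "Suc k \<le> i \<and> j' < j" if "(i, j) \<in> matched es (Suc k) J'" for i j
    using matched_bounds[OF 2(1) J(3) that] 2(4) J by auto
  then have "(k, j') \<notin> matched es (Suc k) J'" by fastforce
  moreover have "j' \<notin> set J'" using 2(4) J by auto
  moreover have "sorted_wrt (<) J'" using 2(4) J by simp
  note IH = 2(2)[OF J(3) this, of "Suc k"]
  moreover have "noncrossing (insert (k, j') (matched es (Suc k) J'))"
    unfolding noncrossing_def
  proof (intro allI impI)
    fix p q p' q'
    assume *: "(p, q) \<in> insert (k, j') (matched es (Suc k) J')"
      "(p', q') \<in> insert (k, j') (matched es (Suc k) J')"
    have "(p, q) \<in> matched es (Suc k) J' \<Longrightarrow> (p', q') \<in> matched es (Suc k) J' \<Longrightarrow> p < p' \<longleftrightarrow> q < q'"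
      using IH unfolding noncrossing_def by blast
    then show "p < p' \<longleftrightarrow> q < q'" using * b[of p q] b[of p' q'] by auto
  qed
  ultimately show ?case using J by (auto simp: num_edits_def)
next
  case (3 es x y a)
  from 3(2)[OF 3(3,4), of "Suc k"] show ?case by (auto simp: num_edits_def)
next
  case (4 es x y a)
  then obtain j' J' where J: "J = j' # J'" "y = map f J'" by auto
  have "sorted_wrt (<) J'" "j' \<notin> set J'" "\<forall>j\<in>set J'. j' < j" using 4(4) J by auto
  with 4(2)[OF J(2) this(1), of k] show ?case using J by (auto simp: num_edits_def)
qed

text \<open>A script matches each position at most once, so a list grows by at most one element per
  round. This is how the number of rounds comes to bound the list size.\<close>

lemma collect_nth:
  "edits es W V \<Longrightarrow> V = map f J \<Longrightarrow> length Ss = length W \<Longrightarrow>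
    length (collect es (map g J) Ss) = length W \<and>
    (\<forall>i<length W. set (collect es (map g J) Ss ! i) = set (Ss ! i) \<union> {g j | j. (k + i, j) \<in> matched es k J} \<and>
      (distinct (Ss ! i) \<longrightarrow> distinct (collect es (map g J) Ss ! i)) \<and>
      length (collect es (map g J) Ss ! i) \<le> Suc (length (Ss ! i)))"
proof (induction arbitrary: J Ss k rule: edits.induct)
  case 1
  then show ?case by simp
next
  case (2 es x y a)
  then obtain j' J' where J: "J = j' # J'" "a = f j'" "y = map f J'" by auto
  obtain S Ss' where Ss: "Ss = S # Ss'" "length Ss' = length x" using 2(4) by (cases Ss) auto
  have "i = k \<Longrightarrow> (i, j) \<notin> matched es (Suc k) J'" for i j
    using matched_bounds[OF 2(1) J(3)] by fastforce
  with 2(2)[OF J(3) Ss(2), of "Suc k"] show ?case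
    using J Ss by (auto simp: nth_Cons' less_Suc_eq_0_disj List.insert_def)
next
  case (3 es x y a)
  obtain S Ss' where Ss: "Ss = S # Ss'" "length Ss' = length x" using 3(4) by (cases Ss) auto
  have "i = k \<Longrightarrow> (i, j) \<notin> matched es (Suc k) J" for i j
    using matched_bounds[OF 3(1) 3(3)] by fastforce
  with 3(2)[OF 3(3) Ss(2), of "Suc k"] show ?case
    using Ss by (auto simp: nth_Cons' less_Suc_eq_0_disj)
next
  case (4 es x y a)
  then obtain j' J' where J: "J = j' # J'" "y = map f J'" by auto
  from 4(2)[OF J(2) 4(4), of k] show ?case using J by auto
qed

section \<open>Repeated rounds\<close>

text \<open>Survivors are recorded as positions in the original \<open>y\<close>, so that the
  matchings of different rounds can be compared with each other and with the actual
  transmission.\<close>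

primrec survivors :: "('b list \<Rightarrow> 'a edit list) \<Rightarrow> 'b list \<Rightarrow> nat \<Rightarrow> nat list" where
  "survivors E y 0 = [0..<length y]"
| "survivors E y (Suc r) = leftover (E (map ((!) y) (survivors E y r))) (survivors E y r)"

definition remaining :: "('b list \<Rightarrow> 'a edit list) \<Rightarrow> 'b list \<Rightarrow> nat \<Rightarrow> 'b list" where
  "remaining E y r = map ((!) y) (survivors E y r)"

definition round_pairs :: "('b list \<Rightarrow> 'a edit list) \<Rightarrow> 'b list \<Rightarrow> nat \<Rightarrow> (nat \<times> nat) set" where
  "round_pairs E y r = matched (E (remaining E y r)) 0 (survivors E y r)"

primrec symbol_lists ::
  "(('a \<times> 'c) list \<Rightarrow> 'b edit list) \<Rightarrow> ('a \<times> 'c) list \<Rightarrow> nat \<Rightarrow> nat \<Rightarrow> 'a list list" where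
  "symbol_lists E y n 0 = replicate n []"
| "symbol_lists E y n (Suc r) =
     collect (E (remaining E y r)) (map fst (remaining E y r)) (symbol_lists E y n r)"

lemma remaining_0 [simp]: "remaining E y 0 = y"
  by (simp add: remaining_def map_nth)

lemma remaining_Suc: "remaining E y (Suc r) = leftover (E (remaining E y r)) (remaining E y r)"
  by (simp add: remaining_def leftover_map)

lemma indexed_nth:
  assumes "length x = n" "length T = n" "length I = n" "i < n"
  shows "indexed T I x ! i = (x ! i, T ! i, I ! i)" "zip T I ! i = (T ! i, I ! i)"
  using assms by (simp_all add: indexed_def)

text \<open>\<open>E\<close> stands for the scripts found by the indexing algorithm. Their
  approximation quality enters only in the counting argument.\<close>

locale rounds =
  fixes E :: "('a \<times> 'b \<times> 'c) list \<Rightarrow> ('b \<times> 'c) edit list" and y and W :: "('b \<times> 'c) list" and K :: nat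
  assumes edits: "\<And>r. r < K \<Longrightarrow> edits (E (remaining E y r)) W (map snd (remaining E y r))"
begin

abbreviation "J \<equiv> survivors E y"
abbreviation "P \<equiv> round_pairs E y"

lemma edits_J: "r < K \<Longrightarrow> edits (E (remaining E y r)) W (map (\<lambda>j. snd (y ! j)) (J r))"
  using edits by (simp add: remaining_def comp_def)

lemma J_Suc: "J (Suc r) = leftover (E (remaining E y r)) (J r)"
  by (simp add: remaining_def)

lemma sorted_J: "r \<le> K \<Longrightarrow> sorted_wrt (<) (J r)"
proof (induction r)
  case (Suc r)
  then show ?case using matched_card[OF edits_J HOL.refl, of r] unfolding J_Suc by auto
qed (simp add: sorted_wrt_upt)

lemma round_pairs:
  assumes "r < K"
  shows "noncrossing (P r)" "finite (P r)" "card (P r) + length (J (Suc r)) = length (J r)"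
    "num_edits (E (remaining E y r)) + 2 * card (P r) = length W + length (J r)"
    "set (J (Suc r)) \<union> snd ` P r = set (J r)"
  using matched_card[OF edits_J[OF assms] HOL.refl, of 0] sorted_J[of r] assms
  unfolding J_Suc round_pairs_def by auto

lemma round_pairs_nth:
  assumes "r < K" "(i, j) \<in> P r"
  shows "i < length W" "W ! i = snd (y ! j)"
  using matched_bounds[OF edits_J[OF assms(1)] HOL.refl assms(2)[unfolded round_pairs_def]] by auto

lemma J_antimono: "r \<le> r' \<Longrightarrow> r' \<le> K \<Longrightarrow> set (J r') \<subseteq> set (J r)"
proof (induction r' rule: dec_induct)
  case (step r')
  then show ?case using round_pairs(5)[of r'] by (auto simp del: survivors.simps)
qed simp

lemma J_bound: "r \<le> K \<Longrightarrow> j \<in> set (J r) \<Longrightarrow> j < length y"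
  using J_antimono[of 0 r] by auto

lemma length_J: "r \<le> K \<Longrightarrow> length (J r) + (\<Sum>i<r. card (P i)) = length y"
proof (induction r)
  case (Suc r)
  then show ?case using round_pairs(3)[of r] by (simp del: survivors.simps)
qed simp

lemma matched_or_survives:
  "r \<le> K \<Longrightarrow> j < length y \<Longrightarrow> j \<in> set (J r) \<or> (\<exists>r'<r. \<exists>i. (i, j) \<in> P r')"
proof (induction r)
  case (Suc r)
  then have J: "set (J (Suc r)) \<union> snd ` P r = set (J r)" using round_pairs(5)[of r] by simp
  from Suc consider "j \<in> set (J r)" | r' i where "r' < r" "(i, j) \<in> P r'" by auto
  then show ?case
  proof cases
    case 1
    then consider "j \<in> set (J (Suc r))" | "j \<in> snd ` P r" using J by blast
    then show ?thesis
    proof cases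
      case 2
      then obtain i where "(i, j) \<in> P r" by force
      then show ?thesis by blast
    qed blast
  next
    case 2
    then show ?thesis using less_SucI by blast
  qed
qed simp

lemma symbol_lists:
  "r \<le> K \<Longrightarrow> length (symbol_lists E y (length W) r) = length W \<and>
    (\<forall>i<length W. set (symbol_lists E y (length W) r ! i) = {fst (y ! j) | j. \<exists>r'<r. (i, j) \<in> P r'} \<and>
       distinct (symbol_lists E y (length W) r ! i) \<and>
       length (symbol_lists E y (length W) r ! i) \<le> r)"
proof (induction r)
  case (Suc r)
  have *: "map fst (remaining E y r) = map (\<lambda>j. fst (y ! j)) (J r)"
    by (simp add: remaining_def)
  have IH: "length (symbol_lists E y (length W) r) = length W"
    "\<And>i. i < length W \<Longrightarrow> set (symbol_lists E y (length W) r ! i) = {fst (y ! j) | j. \<exists>r'<r. (i, j) \<in> P r'} \<and>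
       distinct (symbol_lists E y (length W) r ! i) \<and>
       length (symbol_lists E y (length W) r ! i) \<le> r"
    using Suc by auto
  have "r < K" using Suc by simp
  note c = collect_nth[OF edits_J[OF this] HOL.refl IH(1), of "\<lambda>j. fst (y ! j)" 0, folded *,
      folded symbol_lists.simps(2) round_pairs_def, unfolded add_0]
  have "set (symbol_lists E y (length W) (Suc r) ! i) = {fst (y ! j) | j. \<exists>r'<Suc r. (i, j) \<in> P r'} \<and>
       distinct (symbol_lists E y (length W) (Suc r) ! i) \<and>
       length (symbol_lists E y (length W) (Suc r) ! i) \<le> Suc r" if "i < length W" for i
  proof -
    have "set (symbol_lists E y (length W) (Suc r) ! i) =
        {fst (y ! j) | j. \<exists>r'<r. (i, j) \<in> P r'} \<union> {fst (y ! j) | j. (i, j) \<in> P r}"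
      "distinct (symbol_lists E y (length W) (Suc r) ! i)"
      "length (symbol_lists E y (length W) (Suc r) ! i) \<le> Suc (length (symbol_lists E y (length W) r ! i))"
      using c IH(2)[OF that] that by blast+
    moreover have "{fst (y ! j) | j. \<exists>r'<Suc r. (i, j) \<in> P r'} =
        {fst (y ! j) | j. \<exists>r'<r. (i, j) \<in> P r'} \<union> {fst (y ! j) | j. (i, j) \<in> P r}"
      unfolding less_Suc_eq by blast
    ultimately show ?thesis using IH(2)[OF that] by (metis Suc_le_mono order.trans)
  qed
  with c show ?case by blast
qed simp

text \<open>Indices of surviving symbols are positions in the original word; \<open>pos\<close> translates them to
  positions in the remaining word.\<close>

lemma matching_remaining:
  assumes "matching W (map snd y) U" "r < K" "snd ` U \<subseteq> set (J K)"
  shows "ED W (map snd (remaining E y r)) + 2 * card U \<le> length W + length (J r)"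
proof -
  let ?J = "J r"
  define pos where "pos = inv_into {..<length ?J} ((!) ?J)"
  have img: "(!) ?J ` {..<length ?J} = set ?J" by (auto simp: set_conv_nth)
  have sub: "j \<in> set ?J" if "j \<in> snd ` U" for j
    using assms J_antimono[of r K] that by auto
  have pos: "pos j < length ?J" "?J ! pos j = j" if "j \<in> snd ` U" for j
    using sub[OF that] img inv_into_into[of j "(!) ?J" "{..<length ?J}"]
      f_inv_into_f[of j "(!) ?J" "{..<length ?J}"] unfolding pos_def by auto
  have mono: "pos j < pos j' \<longleftrightarrow> j < j'" if "j \<in> snd ` U" "j' \<in> snd ` U" for j j'
    using pos[OF that(1)] pos[OF that(2)] sorted_wrt_nth_less[OF sorted_J, of r] assms(2)
    by (metis less_imp_le linorder_neqE_nat not_less_iff_gr_or_eq)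
  have "pos j < length (map snd (remaining E y r)) \<and>
      map snd (remaining E y r) ! pos j = map snd y ! j" if "j \<in> snd ` U" for j
    using pos[OF that] J_bound[of r j] sub[OF that] assms(2) by (simp add: remaining_def)
  note m = matching_reindex[OF assms(1) mono this]
  show ?thesis using matching_ED[OF m(1)] m(2) by (simp add: remaining_def)
qed

end

section \<open>Counting the positions whose lists contain the transmitted symbol\<close>

theorem rounds_agreement:
  fixes x :: "'a list" and T :: "'b list" and I :: "'c list"
  assumes len: "length x = n" "length T = n" "length I = n"
    and ind: "indel (indexed T I x) d e y" and e: "real e \<le> \<gamma> * real n"
    and sync: "synchronization_string \<epsilon>\<^sub>s T" and nonneg: "\<epsilon>\<^sub>s \<ge> 0" "\<epsilon>\<^sub>I \<ge> 0"
    and rounds: "rounds E y (zip T I) K"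
    and approx: "\<And>r. r < K \<Longrightarrow> real (num_edits (E (remaining E y r))) \<le>
       (1 + \<epsilon>\<^sub>I) * real (ED (zip T I) (map snd (remaining E y r)))"
    and par: "real K * \<epsilon>\<^sub>s \<le> \<epsilon> / 3" "\<epsilon>\<^sub>I * (1 + \<gamma> / 2) \<le> \<epsilon> / 3" "1 + \<gamma> \<le> (real K + 1) * (\<epsilon> / 3)"
    and "\<epsilon> \<ge> 0"
  shows "real n - real d - \<epsilon> * real n \<le>
    real (card {i. i < n \<and> x ! i \<in> set (symbol_lists E y n K ! i)})"
proof -
  interpret rounds E y "zip T I" K by (rule rounds)
  have lenW: "length (zip T I) = n" using len by simp
  have lenX: "length (indexed T I x) = n" using len by (simp add: indexed_def)
  obtain G where G: "matching (indexed T I x) y G" "n \<le> card G + d" "length y + d = n + e"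
    using indel_matching[OF ind] lenX by auto
  have finG: "finite G" using G(1) by (rule matching_finite)
  have ncG: "noncrossing G" using G(1) by (simp add: matching_def)
  have inG: "i < n" "j < length y" "x ! i = fst (y ! j)" "zip T I ! i = snd (y ! j)"
    if "(i, j) \<in> G" for i j
  proof -
    show i: "i < n" "j < length y" using G(1) that lenX by (auto simp: matching_def)
    have "y ! j = (x ! i, T ! i, I ! i)"
      using G(1) that indexed_nth[OF len i(1)] by (auto simp: matching_def)
    then show "x ! i = fst (y ! j)" "zip T I ! i = snd (y ! j)" using indexed_nth[OF len i(1)] by auto
  qed
  \<comment> \<open>\<open>G\<close> pairs undeleted symbols with their places in \<open>y\<close>.
    Such a symbol is never matched (\<open>U\<close>), matched to a wrong position in some round
    \<open>r\<close> (\<open>X r\<close>), or matched to its own position (\<open>H\<close>). The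
    loss is at most 2\<epsilon>/3 of \<open>n\<close> from \<open>U\<close> and \<epsilon>/3 of
    \<open>n\<close> from all \<open>X r\<close> together.\<close>
  define U where "U = {p \<in> G. snd p \<in> set (J K)}"
  define X where "X r = {p \<in> G. \<exists>i. (i, snd p) \<in> P r \<and> i \<noteq> fst p}" for r
  define H where "H = {p \<in> G. \<exists>r<K. p \<in> P r}"
  define u where "u = card U"
  have lenY: "real (length y) \<le> (1 + \<gamma>) * real n" using G(3) e by (simp add: algebra_simps)

  have "matching (zip T I) (map snd y) U"
    using noncrossing_subset[OF ncG, of U] inG len by (fastforce simp: U_def matching_def)
  then have LCS: "ED (zip T I) (map snd (remaining E y r)) + 2 * u \<le> n + length (J r)" if "r < K" for r
    using matching_remaining[of U r] that lenW by (auto simp: U_def u_def)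
  have lower: "(1 + \<epsilon>\<^sub>I) * real u - \<epsilon> / 3 * real n \<le> real (card (P r))" if "r < K" for r
  proof -
    have J: "real (length (J r)) \<le> (1 + \<gamma>) * real n"
      using length_J[of r] that lenY by linarith
    have "real n + real (length (J r)) - 2 * real (card (P r)) = real (num_edits (E (remaining E y r)))"
      using round_pairs(4)[OF that] lenW by linarith
    also have "\<dots> \<le> (1 + \<epsilon>\<^sub>I) * real (ED (zip T I) (map snd (remaining E y r)))"
      by (rule approx[OF that])
    also have "\<dots> \<le> (1 + \<epsilon>\<^sub>I) * (real n + real (length (J r)) - 2 * real u)"
      using LCS[OF that] nonneg by (intro mult_left_mono) auto
    finally have "2 * (1 + \<epsilon>\<^sub>I) * real u - \<epsilon>\<^sub>I * (real n + real (length (J r))) \<le> 2 * real (card (P r))"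
      by (simp add: algebra_simps)
    moreover have "\<epsilon>\<^sub>I * (real n + real (length (J r))) \<le> \<epsilon>\<^sub>I * (real n + (1 + \<gamma>) * real n)"
      using J nonneg by (intro mult_left_mono) auto
    \<comment> \<open>The two strings have total length at most (2 + \<gamma>) n, which is the
      origin of the factor 1 + \<gamma>/2 in the choice of
      \<open>\<epsilon>\<^sub>I\<close>.\<close>
    moreover have "\<epsilon>\<^sub>I * (real n + (1 + \<gamma>) * real n) = 2 * (\<epsilon>\<^sub>I * (1 + \<gamma> / 2)) * real n"
      by (simp add: algebra_simps)
    moreover have "2 * (\<epsilon>\<^sub>I * (1 + \<gamma> / 2)) * real n \<le> 2 * (\<epsilon> / 3) * real n"
      using par(2) by (intro mult_right_mono mult_left_mono) auto
    ultimately show ?thesis by linarith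
  qed
  have "u \<le> length (J K)"
  proof -
    have "u = card (snd ` U)"
      unfolding u_def using inj_on_snd[OF ncG] by (intro card_image[symmetric]) (auto simp: U_def inj_on_def)
    also have "\<dots> \<le> card (set (J K))" by (intro card_mono) (auto simp: U_def)
    finally show ?thesis using card_length le_trans by blast
  qed
  \<comment> \<open>The symbols matched in the various rounds and those never matched are distinct
    symbols of \<open>y\<close>.\<close>
  then have "real u + (\<Sum>r<K. real (card (P r))) \<le> real (length y)"
    using length_J[of K] by (simp flip: of_nat_sum)
  moreover have "(\<Sum>r<K. (1 + \<epsilon>\<^sub>I) * real u - \<epsilon> / 3 * real n) \<le> (\<Sum>r<K. real (card (P r)))"
    using lower by (intro sum_mono) auto
  ultimately have "real u + real K * ((1 + \<epsilon>\<^sub>I) * real u - \<epsilon> / 3 * real n) \<le> (1 + \<gamma>) * real n"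
    using lenY by simp
  moreover have "real K * real u \<le> real K * ((1 + \<epsilon>\<^sub>I) * real u)"
    using nonneg by (intro mult_left_mono) (auto simp: algebra_simps)
  moreover have "(1 + \<gamma>) * real n \<le> (real K + 1) * (\<epsilon> / 3) * real n"
    using par(3) by (intro mult_right_mono) auto
  ultimately have "(real K + 1) * real u \<le> (real K + 1) * (\<epsilon> / 3) * real n + real K * (\<epsilon> / 3 * real n)"
    by (simp add: field_simps)
  \<comment> \<open>Rounding the second \<open>real K\<close> up to \<open>real K + 1\<close>
    creates a common factor that can be cancelled.\<close>
  also have "\<dots> \<le> (real K + 1) * (2 * (\<epsilon> / 3) * real n)"
    using \<open>\<epsilon> \<ge> 0\<close> by (simp add: algebra_simps)
  finally have U: "real u \<le> 2 * (\<epsilon> / 3) * real n" by (simp add: mult_le_cancel_left)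

  have X: "real (card (X r)) \<le> \<epsilon>\<^sub>s * real n" if "r < K" for r
  proof -
    \<comment> \<open>\<open>B\<close> pairs the true position of a received symbol with the
      position that round \<open>r\<close> assigns to it. Both positions carry the same symbol of
      \<open>T\<close>, so \<open>B\<close> is a self-matching of \<open>T\<close> without fixed
      points.\<close>
    define B where "B = {(i, i'). \<exists>j. (i, j) \<in> G \<and> (i', j) \<in> P r \<and> i \<noteq> i'}"
    have "noncrossing B"
      using ncG round_pairs(1)[OF that] unfolding B_def noncrossing_def by blast
    moreover have "i < n \<and> i' < n \<and> T ! i = T ! i'" if "(i, i') \<in> B" for i i'
    proof -
      obtain j where j: "(i, j) \<in> G" "(i', j) \<in> P r" using \<open>(i, i') \<in> B\<close> by (auto simp: B_def)
      have "i < n" "i' < n" "zip T I ! i = zip T I ! i'"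
        using inG[OF j(1)] round_pairs_nth[OF \<open>r < K\<close> j(2)] lenW by auto
      then show ?thesis using len by simp
    qed
    ultimately have B: "matching T T B" using len by (auto simp: matching_def)
    have "real (card B) \<le> \<epsilon>\<^sub>s * real n"
      using synchronization_string_self_matching[OF sync nonneg(1) B] len by (auto simp: B_def)
    moreover have "card (X r) = card (fst ` X r)"
      using inj_on_fst[OF ncG] by (intro card_image[symmetric]) (auto simp: X_def inj_on_def)
    moreover have "fst ` X r = fst ` B" unfolding X_def B_def by force
    moreover have "card (fst ` B) \<le> card B" using matching_finite[OF B] by (rule card_image_le)
    ultimately have "real (card B) \<le> \<epsilon>\<^sub>s * real n" "card (X r) \<le> card B" by simp_all
    then show ?thesis by linarith
  qed
  have "(i, j) \<in> U \<union> (\<Union>r<K. X r) \<union> H" if "(i, j) \<in> G" for i j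
    using matched_or_survives[of K j] inG(2)[OF that] that by (fastforce simp: U_def X_def H_def)
  then have "G \<subseteq> U \<union> (\<Union>r<K. X r) \<union> H" by auto
  then have "card G \<le> card (U \<union> (\<Union>r<K. X r) \<union> H)"
    using finG by (intro card_mono) (auto simp: U_def X_def H_def)
  also have "\<dots> \<le> card U + card (\<Union>r<K. X r) + card H"
    by (meson add_mono card_Un_le le_refl le_trans)
  finally have "real (card G) \<le> real u + real (card (\<Union>r<K. X r)) + real (card H)"
    by (simp add: u_def)
  moreover have "real (card (\<Union>r<K. X r)) \<le> \<epsilon> / 3 * real n"
  proof -
    have "real (card (\<Union>r<K. X r)) \<le> (\<Sum>r<K. real (card (X r)))"
      using card_UN_le[of "{..<K}" X] by (simp flip: of_nat_sum)
    also have "\<dots> \<le> (\<Sum>r<K. \<epsilon>\<^sub>s * real n)" using X by (intro sum_mono) auto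
    also have "\<dots> = real K * \<epsilon>\<^sub>s * real n" by simp
    also have "\<dots> \<le> \<epsilon> / 3 * real n" using par(1) by (intro mult_right_mono) auto
    finally show ?thesis .
  qed
  moreover have "card H \<le> card {i. i < n \<and> x ! i \<in> set (symbol_lists E y n K ! i)}"
  proof -
    have "card H = card (fst ` H)"
      using inj_on_fst[OF ncG] by (intro card_image[symmetric]) (auto simp: H_def inj_on_def)
    also have "\<dots> \<le> card {i. i < n \<and> x ! i \<in> set (symbol_lists E y n K ! i)}"
    proof (rule card_mono)
      show "fst ` H \<subseteq> {i. i < n \<and> x ! i \<in> set (symbol_lists E y n K ! i)}"
      proof clarify
        fix i j assume "(i, j) \<in> H"
        then obtain r where r: "r < K" "(i, j) \<in> P r" and G: "(i, j) \<in> G" by (auto simp: H_def)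
        have "set (symbol_lists E y n K ! i) = {fst (y ! j) | j. \<exists>r<K. (i, j) \<in> P r}"
          using symbol_lists[of K, unfolded lenW] inG(1)[OF G] by blast
        with r inG[OF G] show "fst (i, j) < n \<and> x ! fst (i, j) \<in> set (symbol_lists E y n K ! fst (i, j))"
          by auto
      qed
    qed simp
    finally show ?thesis .
  qed
  ultimately show ?thesis using G(2) U by linarith
qed

section \<open>The encoding and decoding programs\<close>

text \<open>The values occur in equational premises, so that they can be checked by
  simplification.\<close>

lemma computes_callp':
  assumes "computes p u w c" "ev e v = u" "ev f (Cell v w) = z" "c + ecost e + ecost f + 8 \<le> c'"
  shows "computes (callp e p f) v z c'"
  using computes_mono[OF computes_callp[of p e v w c f]] assms by auto

lemma computes_seqp':
  assumes "computes p v w c" "computes q w u d" "c + d + 2 \<le> c'"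
  shows "computes (seqp p q) v u c'"
  using computes_mono[OF computes_seqp[OF assms(1,2)] assms(3)] .

lemma left_vpair [simp]: "left (vpair f g p) = f (fst p)"
  and right_vpair [simp]: "right (vpair f g p) = g (snd p)"
  by (cases p; simp)+

section \<open>Applying an edit script to the word and the lists\<close>

text \<open>Expressions have no loops, so the search is unrolled to depth \<open>k\<close>. The
  lists never grow beyond the number of rounds, which makes the cost a constant. Numbers are equal
  when both truncated differences vanish.\<close>

fun member_expr :: "nat \<Rightarrow> expr" where
  "member_expr 0 = Lit 0"
| "member_expr (Suc k) = IfCell (Tl Input)
     (IfPos (Plus (Minus (Hd Input) (Hd (Tl Input))) (Minus (Hd (Tl Input)) (Hd Input)))
       (After (member_expr k) (Join (Hd Input) (Tl (Tl Input)))) (Lit 1))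
     (Lit 0)"

lemma ev_member_expr:
  "length xs \<le> k \<Longrightarrow> ev (member_expr k) (Cell (Num x) (vstr xs)) = Num (if x \<in> set xs then 1 else 0)"
proof (induction k arbitrary: xs)
  case (Suc k)
  then show ?case by (cases xs) auto
qed simp

text \<open>The input pair itself already encodes the extended list, and \<open>Tl Input\<close> is
  the old one.\<close>

definition insert_expr :: "nat \<Rightarrow> expr" where
  "insert_expr k = IfPos (member_expr k) (Tl Input) Input"

lemma ev_insert_expr:
  "length xs \<le> k \<Longrightarrow> ev (insert_expr k) (Cell (Num x) (vstr xs)) = vstr (List.insert x xs)"
  by (simp add: insert_expr_def ev_member_expr)

text \<open>The input is \<open>(e, ((y, Ss), (y', Ss')))\<close>: an edit, the rest of the two lists it is
  applied to, and the output accumulated in reverse order.\<close>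

definition edit_step :: "nat \<Rightarrow> expr" where
  "edit_step k =
     (let e = Hd Input; y = Hd (Hd (Tl Input)); Ss = Tl (Hd (Tl Input));
          y' = Hd (Tl (Tl Input)); Ss' = Tl (Tl (Tl Input))
      in IfCell e (Join (Join (Tl y) Ss) (Join (Join (Hd y) y') Ss'))
        (IfPos e (Join (Join y (Tl Ss)) (Join y' (Join (Hd Ss) Ss')))
          (Join (Join (Tl y) (Tl Ss))
            (Join y' (Join (After (insert_expr k) (Join (Hd (Hd y)) (Hd Ss))) Ss')))))"

text \<open>A single pass computes \<open>leftover\<close> and \<open>collect\<close>, both in
  reverse. The bound on the list lengths is what the unrolled membership test requires.\<close>

lemma fold_edit_step:
  assumes "edits es W V" "V = map snd y" "length Ss = length W" "\<forall>S\<in>set Ss. length S \<le> k"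
  shows "fold (\<lambda>e r. ev (edit_step k) (Cell (vedit f e) r)) es
      (Cell (Cell (vstr3 y) (vlist vstr Ss)) (Cell (vstr3 y') (vlist vstr Ss'))) =
    Cell (Cell (Num 0) (Num 0)) (Cell (vstr3 (rev (leftover es y) @ y'))
      (vlist vstr (rev (collect es (map fst y) Ss) @ Ss')))"
  using assms
proof (induction arbitrary: y Ss y' Ss' rule: edits.induct)
  case 1
  then show ?case by simp
next
  case (2 es x v a)
  then obtain b z where y: "y = b # z" "v = map snd z" by auto
  obtain S Ss1 where Ss: "Ss = S # Ss1" "length Ss1 = length x" using 2(4) by (cases Ss) auto
  show ?case
    using 2(2)[OF y(2) Ss(2), of y' "List.insert (fst b) S # Ss'"] 2(5) y Ss
    by (simp add: edit_step_def Let_def ev_insert_expr)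
next
  case (3 es x v a)
  obtain S Ss1 where Ss: "Ss = S # Ss1" "length Ss1 = length x" using 3(4) by (cases Ss) auto
  show ?case
    using 3(2)[OF 3(3) Ss(2), of y' "S # Ss'"] 3(5) Ss
    by (simp add: edit_step_def Let_def)
next
  case (4 es x v a)
  then obtain b z where y: "y = b # z" "v = map snd z" by auto
  show ?case
    using 4(2)[OF y(2) 4(4,5), of "b # y'" Ss'] y
    by (simp add: edit_step_def Let_def)
qed

definition seconds :: prog where
  "seconds = mapp (code (Tl (Hd Input)))"

lemma computes_seconds:
  "computes seconds (Cell (vlist (vpair f g) xs) v) (vlist g (map snd xs)) (64 * length xs + 80)"
proof -
  have "computes (code (Tl (Hd Input))) (Cell (vpair f g x) v) (g (snd x)) 3" for x
    using computes_code[of "Tl (Hd Input)" "Cell (vpair f g x) v"] by (simp add: eval_nat_numeral)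
  from computes_mapp[of xs _ "vpair f g" v g snd "\<lambda>_. 3", OF this] show ?thesis
    unfolding seconds_def by (rule computes_mono) (simp add: sum_list_triv)
qed

lemma computes_mapp_const:
  "computes (mapp (code (Lit k))) (Cell (vlist g xs) v) (vlist (\<lambda>_. Num k) xs) (61 * length xs + 80)"
proof -
  have "computes (code (Lit k)) (Cell (g x) v) (Num k) 1" for x
    using computes_code[of "Lit k" "Cell (g x) v"] by simp
  from computes_mapp[of xs "code (Lit k)" g v "\<lambda>_. Num k" "\<lambda>x. x" "\<lambda>_. 1", OF this]
  show ?thesis by (simp add: sum_list_triv mult.commute)
qed

text \<open>The state consists of the fixed string \<open>zip T I\<close>, the part of the received word that is
  still unmatched, and the lists of symbols collected for each position.\<close>

definition roundp :: "nat \<Rightarrow> prog \<Rightarrow> prog" where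
  "roundp k p =
     seqp (callp (Join (Hd (Tl Input)) (Lit 0)) seconds Input)
    (seqp (callp (Join (Hd (Hd Input)) (Tl Input)) p (Join (Hd (Hd Input)) (Tl Input)))
    (seqp (callp (Join (Tl Input) (Join (Tl (Hd Input)) (Join (Lit 0) (Lit 0))))
             (foldp (code (edit_step k))) (Join (Hd (Hd (Hd Input))) (Tl (Tl Input))))
    (seqp (callp (Join (Hd (Tl Input)) (Lit 0)) revp
             (Join (Hd (Hd Input)) (Join (Tl Input) (Tl (Tl (Hd Input))))))
          (callp (Join (Tl (Tl Input)) (Lit 0)) revp
             (Join (Hd (Hd Input)) (Join (Hd (Tl (Hd Input))) (Tl Input)))))))"

lemma length_leftover: "length (leftover es y) \<le> length y"
  by (induction es y rule: leftover.induct) auto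

text \<open>Apart from the call of \<open>p\<close> the work is linear, because a script has at most
  one entry per symbol of the two strings.\<close>

lemma computes_roundp:
  fixes W :: "(nat \<times> nat) list"
  assumes p: "computes p (Cell (vstr2 W) (vstr2 (map snd y))) (vlist (vedit (vpair Num Num)) es) c"
    and es: "edits es W (map snd y)" and Ss: "length Ss = length W" "\<forall>S\<in>set Ss. length S \<le> k"
  shows "computes (roundp k p) (Cell (vstr2 W) (Cell (vstr3 y) (vlist vstr Ss)))
    (Cell (vstr2 W) (Cell (vstr3 (leftover es y)) (vlist vstr (collect es (map fst y) Ss))))
    (c + (ecost (edit_step k) + 100) * (length W + length y) + 400)"
proof -
  let ?C = "ecost (edit_step k)"
  let ?v = "Cell (vstr2 W) (Cell (vstr3 y) (vlist vstr Ss))"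
  let ?y = "leftover es y" and ?S = "collect es (map fst y) Ss"
  have 1: "computes (callp (Join (Hd (Tl Input)) (Lit 0)) seconds Input)
      ?v (Cell ?v (vstr2 (map snd y))) (64 * length y + 110)"
    by (rule computes_callp'[OF computes_seconds[of Num "vpair Num Num" y "Num 0"]]) simp+
  have 2: "computes (callp (Join (Hd (Hd Input)) (Tl Input)) p (Join (Hd (Hd Input)) (Tl Input)))
      (Cell ?v (vstr2 (map snd y))) (Cell ?v (vlist (vedit (vpair Num Num)) es)) (c + 40)"
    by (rule computes_callp'[OF p]) simp+
  note f = computes_foldp_code[of "edit_step k" "vedit (vpair Num Num)" es
      "Cell (Cell (vstr3 y) (vlist vstr Ss)) (Cell (vstr3 []) (vlist vstr []))",
      unfolded fold_edit_step[OF es HOL.refl Ss]]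
  have 3: "computes (callp (Join (Tl Input) (Join (Tl (Hd Input)) (Join (Lit 0) (Lit 0))))
             (foldp (code (edit_step k))) (Join (Hd (Hd (Hd Input))) (Tl (Tl Input))))
      (Cell ?v (vlist (vedit (vpair Num Num)) es))
      (Cell (vstr2 W) (Cell (vstr3 (rev ?y)) (vlist vstr (rev ?S)))) ((?C + 5) * length es + 43)"
    by (rule computes_callp'[OF f]) simp+
  have 4: "computes (callp (Join (Hd (Tl Input)) (Lit 0)) revp
             (Join (Hd (Hd Input)) (Join (Tl Input) (Tl (Tl (Hd Input))))))
      (Cell (vstr2 W) (Cell (vstr3 (rev ?y)) (vlist vstr (rev ?S))))
      (Cell (vstr2 W) (Cell (vstr3 ?y) (vlist vstr (rev ?S)))) (6 * length y + 43)"
    by (rule computes_callp'[OF computes_revp[of _ "rev ?y" "[]"]])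
      ((use length_leftover[of es y] in simp)+)
  have "length ?S = length W"
    using collect_nth[OF es, of snd y Ss fst] Ss by simp
  then have 5: "computes (callp (Join (Tl (Tl Input)) (Lit 0)) revp
             (Join (Hd (Hd Input)) (Join (Hd (Tl (Hd Input))) (Tl Input))))
      (Cell (vstr2 W) (Cell (vstr3 ?y) (vlist vstr (rev ?S))))
      (Cell (vstr2 W) (Cell (vstr3 ?y) (vlist vstr ?S))) (6 * length W + 43)"
    by (intro computes_callp'[OF computes_revp[of _ "rev ?S" "[]"]]) simp+
  have "(?C + 5) * length es \<le> (?C + 5) * (length W + length y)"
    using edits_length[OF es] by (intro mult_left_mono) auto
  then show ?thesis
    unfolding roundp_def
    by (intro computes_seqp'[OF 1 computes_seqp'[OF 2 computes_seqp'[OF 3 computes_seqp'[OF 4 5 order.refl]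
        order.refl] order.refl]]) (simp add: algebra_simps)
qed

text \<open>The number of rounds depends only on \<epsilon> and \<gamma>, so it can be built into
  the program text.\<close>

primrec iterp :: "prog \<Rightarrow> nat \<Rightarrow> prog" where
  "iterp p 0 = code Input"
| "iterp p (Suc r) = seqp (iterp p r) p"

lemma computes_iterp:
  assumes "\<And>r. r < k \<Longrightarrow> computes p (s r) (s (Suc r)) c"
  shows "computes (iterp p k) (s 0) (s k) (k * (c + 2) + 1)"
  using assms
proof (induction k)
  case 0
  then show ?case using computes_code[of Input "s 0"] by simp
next
  case (Suc k)
  have "computes (iterp p k) (s 0) (s k) (k * (c + 2) + 1)" using Suc by simp
  from computes_seqp'[OF this Suc.prems[of k]] show ?case by simp
qed

section \<open>Programs for indexing, encoding and decoding\<close>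

text \<open>A fold reads only one list; the unread parts of the other two travel in the
  accumulator.\<close>

definition zip_step :: expr where
  "zip_step =
     (let T = Hd (Hd (Tl Input)); I = Tl (Hd (Tl Input)); out = Tl (Tl Input)
      in Join (Join (Tl T) (Tl I)) (Join (Join (Hd Input) (Join (Hd T) (Hd I))) out))"

definition indexp :: prog where
  "indexp = seqp
     (callp (Join (Hd Input) (Join (Tl Input) (Lit 0))) (foldp (code zip_step))
       (Join (Tl (Tl Input)) (Lit 0)))
     revp"

lemma fold_zip_step:
  "length T = length x \<Longrightarrow> length I = length x \<Longrightarrow>
   fold (\<lambda>a r. ev zip_step (Cell (Num a) r)) x (Cell (Cell (vstr T) (vstr I)) (vstr3 out)) =
     Cell (Cell (Num 0) (Num 0)) (vstr3 (rev (indexed T I x) @ out))"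
proof (induction x arbitrary: T I out)
  case (Cons a x)
  then obtain t T' i I' where "T = t # T'" "length T' = length x" "I = i # I'" "length I' = length x"
    by (metis length_Suc_conv)
  then show ?case
    using Cons.IH[of T' I' "(a, t, i) # out"] by (simp add: zip_step_def indexed_def Let_def)
qed (simp add: indexed_def)

lemma length_indexed: "length T = length x \<Longrightarrow> length I = length x \<Longrightarrow> length (indexed T I x) = length x"
  by (simp add: indexed_def)

lemma computes_indexp:
  assumes "length T = length x" "length I = length x"
  shows "computes indexp (Cell (vstr x) (Cell (vstr T) (vstr I))) (vstr3 (indexed T I x))
    (80 * length x + 80)"
proof -
  note f = computes_foldp_code[of zip_step Num x "Cell (Cell (vstr T) (vstr I)) (vstr3 [])",
      unfolded fold_zip_step[OF assms]]
  have 1: "computes (callp (Join (Hd Input) (Join (Tl Input) (Lit 0))) (foldp (code zip_step))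
       (Join (Tl (Tl Input)) (Lit 0))) (Cell (vstr x) (Cell (vstr T) (vstr I)))
      (Cell (vstr3 (rev (indexed T I x))) (Num 0)) ((ecost zip_step + 5) * length x + 40)"
    by (rule computes_callp'[OF f]) simp+
  show ?thesis
    unfolding indexp_def
    by (rule computes_seqp'[OF 1, where d = "6 * length x + 3"])
      (use computes_revp[of _ "rev (indexed T I x)" "[]"] length_indexed[OF assms] in
        \<open>simp_all add: zip_step_def Let_def\<close>)
qed

definition encodep :: "prog \<Rightarrow> prog" where
  "encodep p = seqp
     (callp (Join (Hd Input) (Tl (Tl (Tl Input)))) p
       (Join (Tl Input) (Join (Hd (Tl (Hd Input))) (Hd (Tl (Tl (Hd Input)))))))
     indexp"

lemma computes_encodep:
  assumes "computes p (Cell a m) (vstr x) c" "length T = length x" "length I = length x"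
  shows "computes (encodep p) (Cell a (Cell (vstr T) (Cell (vstr I) m))) (vstr3 (indexed T I x))
    (c + 80 * length x + 150)"
proof -
  have 1: "computes (callp (Join (Hd Input) (Tl (Tl (Tl Input)))) p
       (Join (Tl Input) (Join (Hd (Tl (Hd Input))) (Hd (Tl (Tl (Hd Input)))))))
      (Cell a (Cell (vstr T) (Cell (vstr I) m))) (Cell (vstr x) (Cell (vstr T) (vstr I))) (c + 50)"
    by (rule computes_callp'[OF assms(1)]) simp+
  show ?thesis
    unfolding encodep_def by (rule computes_seqp'[OF 1 computes_indexp[OF assms(2,3)]]) simp
qed

text \<open>\<open>zip T I\<close> is produced by indexing \<open>T\<close> in place of a codeword
  and dropping the first components. Mapping 0, the code of the empty list, along \<open>T\<close>
  gives the initial lists. Then follow the rounds, the list recovery and the indexing of every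
  recovered codeword.\<close>

definition decodep :: "nat \<Rightarrow> prog \<Rightarrow> prog \<Rightarrow> prog" where
  "decodep k p q =
     seqp (callp (Join (Hd (Tl Input)) (Join (Hd (Tl Input)) (Hd (Tl (Tl Input))))) indexp Input)
    (seqp (callp (Join (Tl Input) (Lit 0)) seconds (Join (Hd (Hd Input)) (Tl Input)))
    (seqp (callp (Join (Hd (Tl (Hd Input))) (Lit 0)) (mapp (code (Lit 0)))
       (Join (Hd (Hd Input))
         (Join (Tl (Hd Input)) (Join (Tl (Tl (Tl (Hd (Hd Input))))) (Tl Input)))))
    (seqp (callp (Tl Input) (iterp (roundp k p) k) (Join (Hd (Hd Input)) (Tl (Tl (Tl Input)))))
    (seqp (callp (Join (Hd (Hd Input)) (Tl Input)) q
       (Join (Tl Input) (Join (Hd (Tl (Hd (Hd Input)))) (Hd (Tl (Tl (Hd (Hd Input))))))))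
    (mapp indexp)))))"

lemma vsize_vstr: "vsize (vstr x) = 2 * length x + 1"
  by (induction x) auto

lemma vsize_vstr3: "vsize (vstr3 x) = 6 * length x + 1"
  by (induction x) auto

lemma vsize_vlist: "vsize (vlist f xs) = (\<Sum>x\<leftarrow>xs. vsize (f x) + 1) + 1"
  by (induction xs) auto

text \<open>Indexing the recovered codewords is charged to the size of the output of
  \<open>q\<close>, which \<open>runs_within\<close> counts as part of the time of
  \<open>q\<close>.\<close>

lemma computes_decodep:
  assumes len: "length T = n" "length I = n"
    and rounds: "\<And>r. r < k \<Longrightarrow> computes (roundp k p)
       (Cell (vstr2 (zip T I)) (Cell (vstr3 (ys r)) (vlist vstr (Ss r))))
       (Cell (vstr2 (zip T I)) (Cell (vstr3 (ys (Suc r))) (vlist vstr (Ss (Suc r))))) c"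
    and init: "ys 0 = y" "Ss 0 = replicate n []"
    and q: "computes q (Cell a (vlist vstr (Ss k))) (vlist vstr xs) d"
    and xs: "\<forall>x\<in>set xs. length x = n"
  shows "computes (decodep k p q) (Cell a (Cell (vstr T) (Cell (vstr I) (vstr3 y))))
    (vlist vstr3 (map (indexed T I) xs))
    (205 * n + k * (c + 2) + d + 140 * vsize (vlist vstr xs) + 1000)"
proof -
  let ?v = "Cell a (Cell (vstr T) (Cell (vstr I) (vstr3 y)))"
  let ?w = "\<lambda>r. Cell (vstr2 (zip T I)) (Cell (vstr3 (ys r)) (vlist vstr (Ss r)))"
  have 1: "computes (callp (Join (Hd (Tl Input)) (Join (Hd (Tl Input)) (Hd (Tl (Tl Input))))) indexp Input)
      ?v (Cell ?v (vstr3 (indexed T I T))) (80 * n + 130)"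
    by (rule computes_callp'[OF computes_indexp[of T T I]]) ((use len in simp)+)
  have "map snd (indexed T I T) = zip T I" using len by (simp add: indexed_def)
  then have 2: "computes (callp (Join (Tl Input) (Lit 0)) seconds (Join (Hd (Hd Input)) (Tl Input)))
      (Cell ?v (vstr3 (indexed T I T))) (Cell ?v (vstr2 (zip T I))) (64 * n + 130)"
    by (intro computes_callp'[OF computes_seconds[of Num "vpair Num Num" "indexed T I T" "Num 0"]])
      ((use len length_indexed[of T T I] in simp)+)
  have "vlist (\<lambda>_. Num 0) xs = vlist vstr (replicate (length xs) [])" for xs :: "nat list"
    by (induction xs) auto
  then have m: "computes (mapp (code (Lit 0))) (Cell (vstr T) (Num 0)) (vlist vstr (Ss 0)) (61 * n + 80)"
    using computes_mapp_const[of 0 Num T "Num 0"] init len by simp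
  have 3: "computes (callp (Join (Hd (Tl (Hd Input))) (Lit 0)) (mapp (code (Lit 0)))
       (Join (Hd (Hd Input))
         (Join (Tl (Hd Input)) (Join (Tl (Tl (Tl (Hd (Hd Input))))) (Tl Input)))))
      (Cell ?v (vstr2 (zip T I))) (Cell ?v (?w 0)) (61 * n + 140)"
    by (rule computes_callp'[OF m]) ((use init in simp)+)
  have 4: "computes (callp (Tl Input) (iterp (roundp k p) k) (Join (Hd (Hd Input)) (Tl (Tl (Tl Input)))))
      (Cell ?v (?w 0)) (Cell ?v (vlist vstr (Ss k))) (k * (c + 2) + 30)"
    by (rule computes_callp'[OF computes_iterp[of k _ ?w c]]) ((use rounds in simp)+)
  have 5: "computes (callp (Join (Hd (Hd Input)) (Tl Input)) q
       (Join (Tl Input) (Join (Hd (Tl (Hd (Hd Input)))) (Hd (Tl (Tl (Hd (Hd Input))))))))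
      (Cell ?v (vlist vstr (Ss k))) (Cell (vlist vstr xs) (Cell (vstr T) (vstr I))) (d + 50)"
    by (rule computes_callp'[OF q]) simp+
  have "computes indexp (Cell (vstr x) (Cell (vstr T) (vstr I))) (vstr3 (indexed T I x))
      (80 * length x + 80)" if "x \<in> set xs" for x
    using computes_indexp[of T x I] that xs len by simp
  from computes_mapp[of xs indexp vstr _ vstr3 "indexed T I" "\<lambda>x. 80 * length x + 80", OF this]
  have 6: "computes (mapp indexp) (Cell (vlist vstr xs) (Cell (vstr T) (vstr I)))
      (vlist vstr3 (map (indexed T I) xs)) (140 * vsize (vlist vstr xs) + 80)"
  proof (rule computes_mono)
    have "(\<Sum>x\<leftarrow>xs. 80 * length x + 80 + 60) \<le> (\<Sum>x\<leftarrow>xs. 140 * (vsize (vstr x) + 1))"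
      by (intro sum_list_mono) (simp add: vsize_vstr)
    then show "(\<Sum>x\<leftarrow>xs. 80 * length x + 80 + 60) + 80 \<le> 140 * vsize (vlist vstr xs) + 80"
      unfolding vsize_vlist[of vstr xs] sum_list_const_mult by simp
  qed simp
  show ?thesis
    unfolding decodep_def
    by (rule computes_seqp'[OF 1 computes_seqp'[OF 2 computes_seqp'[OF 3 computes_seqp'[OF 4
        computes_seqp'[OF 5 6 order.refl] order.refl] order.refl] order.refl]]) simp
qed

section \<open>Correctness and running time\<close>

lemma set_leftover: "set (leftover es y) \<subseteq> set y"
  by (induction es y rule: leftover.induct) auto

lemma set_collect:
  "set y \<subseteq> A \<Longrightarrow> \<forall>S\<in>set Ss. set S \<subseteq> A \<Longrightarrow> S \<in> set (collect es y Ss) \<Longrightarrow> set S \<subseteq> A"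
  by (induction es y Ss rule: collect.induct) auto

lemma remaining_subset: "set (remaining E y r) \<subseteq> set y \<and> length (remaining E y r) \<le> length y"
proof (induction r)
  case (Suc r)
  then show ?case
    unfolding remaining_Suc using set_leftover length_leftover by (meson order.trans)
qed simp

lemma set_symbol_lists:
  "set y \<subseteq> A \<times> B \<Longrightarrow> S \<in> set (symbol_lists E y n r) \<Longrightarrow> set S \<subseteq> A"
proof (induction r arbitrary: S)
  case (Suc r)
  have "set (map fst (remaining E y r)) \<subseteq> A"
    using remaining_subset[of E y r] Suc.prems(1) by auto
  from set_collect[OF this] show ?case
    using Suc by (metis symbol_lists.simps(2))
qed simp

lemma near_linear_ge: "n > 0 \<Longrightarrow> real n \<le> near_linear d n"
  unfolding near_linear_def
  by (rule mult_left_mono[of 1 _ "real n", simplified]) (auto intro!: one_le_power)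

text \<open>Remaining words are never longer than \<open>y\<close>, so the guarantee of the indexing
  algorithm for the length factor 1 + \<gamma> serves all rounds at once.\<close>

lemma decode_word:
  fixes T I :: "nat list"
  assumes n: "n > 0" and T: "length T = n" and I: "length I = n"
    and p: "near_linear_indexing p \<epsilon>\<^sub>I c d A\<^sub>I I"
    and q: "recovers_within q a CW A n \<alpha> l B" and CW: "\<And>x. x \<in> CW \<Longrightarrow> length x = n"
    and y: "set y \<subseteq> A \<times> A\<^sub>s \<times> A\<^sub>I" "real (length y) \<le> (1 + \<gamma>) * real n" and kl: "k \<le> l"
  obtains E xs where "rounds E y (zip T I) k"
    "\<forall>r<k. real (num_edits (E (remaining E y r))) \<le>
       (1 + \<epsilon>\<^sub>I) * real (ED (zip T I) (map snd (remaining E y r)))"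
    "\<forall>i<n. set (symbol_lists E y n k ! i) \<subseteq> A \<and> card (set (symbol_lists E y n k ! i)) \<le> l"
    "distinct xs" "set xs = agreeing CW n \<alpha> (\<lambda>i. set (symbol_lists E y n k ! i))"
    "runs_within (decodep k p q) (Cell a (Cell (vstr T) (Cell (vstr I) (vstr3 y))))
      (vlist vstr3 (map (indexed T I) xs))
      (143 * B + (1205 + real k * (\<bar>c (1 + \<gamma>)\<bar> + (real (ecost (edit_step k)) + 100) * (2 + \<gamma>) + 402)) *
        near_linear (d (1 + \<gamma>)) n)"
proof -
  define nl where "nl = near_linear (d (1 + \<gamma>)) n"
  define t where "t = nat \<lfloor>c (1 + \<gamma>) * nl\<rfloor>"
  define script where "script S es \<longleftrightarrow> edits es (zip T I) (map snd S) \<and>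
      real (num_edits es) \<le> (1 + \<epsilon>\<^sub>I) * real (ED (zip T I) (map snd S)) \<and>
      computes p (Cell (vstr2 (zip T I)) (vstr2 (map snd S))) (vlist (vedit (vpair Num Num)) es) t"
    for S :: "(nat \<times> nat \<times> nat) list" and es
  have ex: "\<exists>es. script S es" if "set S \<subseteq> set y" "length S \<le> length y" for S
  proof -
    have "snd ` set (map snd S) \<subseteq> A\<^sub>I" using that(1) y(1) by auto
    moreover have "real (length (map snd S)) \<le> (1 + \<gamma>) * real (length I)"
      using that(2) y(2) I by simp
    ultimately obtain es where es: "edits es (zip T I) (map snd S)"
        "real (num_edits es) \<le> (1 + \<epsilon>\<^sub>I) * real (ED (zip T I) (map snd S))"
        "runs_within p (Cell (vstr2 (zip T I)) (vstr2 (map snd S))) (vlist (vedit (vpair Num Num)) es)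
           (c (1 + \<gamma>) * nl)"
      using p T I unfolding near_linear_indexing_def nl_def by metis
    from es(3) obtain t' where t': "computes p (Cell (vstr2 (zip T I)) (vstr2 (map snd S)))
        (vlist (vedit (vpair Num Num)) es) t'"
        "real (t' + vsize (vlist (vedit (vpair Num Num)) es)) \<le> c (1 + \<gamma>) * nl"
      by (rule runs_within_computes)
    then have "t' \<le> t" unfolding t_def by (intro le_nat_floor) simp
    with es t' show ?thesis unfolding script_def using computes_mono by blast
  qed
  \<comment> \<open>For each word only the existence of a suitable script is known; choosing one
    turns the algorithm into the function that the rounds iterate.\<close>
  define E where "E S = (SOME es. script S es)" for S
  have E: "script (remaining E y r) (E (remaining E y r))" for r
    unfolding E_def[of "remaining E y r"]
    using remaining_subset[of E y r] by (intro someI_ex[OF ex]) auto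
  have lenW: "length (zip T I) = n" using T I by simp
  have rounds: "rounds E y (zip T I) k"
    using E by unfold_locales (simp add: script_def)
  interpret rounds E y "zip T I" k by (rule rounds)
  define Ss where "Ss = symbol_lists E y n"
  have Ss: "length (Ss r) = n" "\<forall>S\<in>set (Ss r). distinct S \<and> length S \<le> k" if "r \<le> k" for r
  proof -
    note * = symbol_lists[OF that, unfolded lenW, folded Ss_def]
    then show "length (Ss r) = n" by blast
    show "\<forall>S\<in>set (Ss r). distinct S \<and> length S \<le> k"
    proof
      fix S assume "S \<in> set (Ss r)"
      then obtain i where "i < n" "S = Ss r ! i" using * by (auto simp: in_set_conv_nth)
      with * have "distinct S" "length S \<le> r" by blast+
      with that show "distinct S \<and> length S \<le> k" by simp
    qed
  qed
  have A: "\<forall>S\<in>set (Ss r). set S \<subseteq> A" for r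
    using set_symbol_lists[OF y(1)] unfolding Ss_def by blast
  have "length (Ss k) = n \<and> (\<forall>S\<in>set (Ss k). distinct S \<and> set S \<subseteq> A \<and> length S \<le> l)"
    using Ss[of k] A[of k] kl by auto
  then obtain xs where xs: "distinct xs" "set xs = agreeing CW n \<alpha> (\<lambda>i. set (Ss k ! i))"
    "runs_within q (Cell a (vlist vstr (Ss k))) (vlist vstr xs) B"
    using q unfolding recovers_within_def by blast
  from xs(3) obtain e where e: "computes q (Cell a (vlist vstr (Ss k))) (vlist vstr xs) e"
    "real (e + vsize (vlist vstr xs)) \<le> B"
    by (rule runs_within_computes)
  define c' where "c' = t + (ecost (edit_step k) + 100) * (n + length y) + 400"
  have round: "computes (roundp k p)
       (Cell (vstr2 (zip T I)) (Cell (vstr3 (remaining E y r)) (vlist vstr (Ss r))))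
       (Cell (vstr2 (zip T I)) (Cell (vstr3 (remaining E y (Suc r))) (vlist vstr (Ss (Suc r))))) c'"
    if "r < k" for r
  proof -
    let ?y = "remaining E y r"
    have "computes (roundp k p) (Cell (vstr2 (zip T I)) (Cell (vstr3 ?y) (vlist vstr (Ss r))))
      (Cell (vstr2 (zip T I)) (Cell (vstr3 (leftover (E ?y) ?y))
        (vlist vstr (collect (E ?y) (map fst ?y) (Ss r)))))
      (t + (ecost (edit_step k) + 100) * (length (zip T I) + length ?y) + 400)"
      using E[of r] Ss[of r] that lenW by (intro computes_roundp) (auto simp: script_def)
    moreover have "t + (ecost (edit_step k) + 100) * (length (zip T I) + length ?y) + 400 \<le> c'"
      using remaining_subset[of E y r] unfolding c'_def lenW by simp
    ultimately show ?thesis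
      unfolding remaining_Suc by (simp add: Ss_def computes_mono)
  qed
  have len: "\<forall>x\<in>set xs. length x = n" using xs(2) CW by (auto simp: agreeing_def)
  have dec: "computes (decodep k p q) (Cell a (Cell (vstr T) (Cell (vstr I) (vstr3 y))))
      (vlist vstr3 (map (indexed T I) xs))
      (205 * n + k * (c' + 2) + e + 140 * vsize (vlist vstr xs) + 1000)"
    by (rule computes_decodep[where ys = "remaining E y", OF T I round _ _ e(1) len])
      (simp_all add: Ss_def)
  \<comment> \<open>A symbol contributes 6 to the size of an indexed word and 2 to that of a plain
    one, hence the factor 3.\<close>
  have out: "vsize (vlist vstr3 (map (indexed T I) xs)) \<le> 3 * vsize (vlist vstr xs)"
  proof -
    have "(\<Sum>x\<leftarrow>xs. vsize (vstr3 (indexed T I x)) + 1) \<le> (\<Sum>x\<leftarrow>xs. 3 * (vsize (vstr x) + 1))"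
      using len T I by (intro sum_list_mono) (simp add: vsize_vstr vsize_vstr3 length_indexed)
    then show ?thesis
      unfolding vsize_vlist[of vstr xs] vsize_vlist[of vstr3] sum_list_const_mult by (simp add: comp_def)
  qed
  let ?C = "real (ecost (edit_step k)) + 100"
  have nl: "real n \<le> nl" using near_linear_ge[OF n] unfolding nl_def .
  then have nl1: "1 \<le> nl" using n by linarith
  \<comment> \<open>\<open>c\<close> may take negative values, for which the rounded bound is 0;
    hence the absolute value.\<close>
  have "real (nat \<lfloor>z\<rfloor>) \<le> \<bar>z\<bar>" for z :: real by linarith
  then have "real t \<le> \<bar>c (1 + \<gamma>) * nl\<bar>" unfolding t_def .
  then have t: "real t \<le> \<bar>c (1 + \<gamma>)\<bar> * nl" using nl1 by (simp add: abs_mult)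
  have "0 \<le> (1 + \<gamma>) * real n" using y(2) by (meson of_nat_0_le_iff order.trans)
  then have g: "0 \<le> 1 + \<gamma>" using n by (simp add: zero_le_mult_iff)
  have "real n + real (length y) \<le> (2 + \<gamma>) * real n" using y(2) by (simp add: algebra_simps)
  also have "\<dots> \<le> (2 + \<gamma>) * nl" using nl g by (intro mult_left_mono) linarith+
  finally have "?C * (real n + real (length y)) \<le> ?C * ((2 + \<gamma>) * nl)" by (intro mult_left_mono) auto
  moreover have "real (c' + 2) = real t + ?C * (real n + real (length y)) + 402"
    unfolding c'_def by simp
  ultimately have "real (c' + 2) \<le> \<bar>c (1 + \<gamma>)\<bar> * nl + ?C * ((2 + \<gamma>) * nl) + 402 * nl"
    using t nl1 by linarith
  then have "real k * real (c' + 2) \<le> real k * ((\<bar>c (1 + \<gamma>)\<bar> + ?C * (2 + \<gamma>) + 402) * nl)"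
    by (intro mult_left_mono) (auto simp: algebra_simps)
  then have rk: "real (k * (c' + 2)) \<le> real k * (\<bar>c (1 + \<gamma>)\<bar> + ?C * (2 + \<gamma>) + 402) * nl"
    by (simp only: of_nat_mult mult.assoc)
  \<comment> \<open>143 = 140 + 3, from indexing the recovered codewords and from writing out the
    result.\<close>
  have "a1 + e + 140 * v + 1000 + v' \<le> a1 + 1000 + 143 * (e + v)" if "v' \<le> 3 * v" for a1 v v' :: nat
    using that by simp
  from of_nat_mono[OF this[OF out]]
  have "real (205 * n + k * (c' + 2) + e + 140 * vsize (vlist vstr xs) + 1000 +
      vsize (vlist vstr3 (map (indexed T I) xs)))
    \<le> real (205 * n + k * (c' + 2) + 1000 + 143 * (e + vsize (vlist vstr xs)))" .
  also have "\<dots> = 205 * real n + real (k * (c' + 2)) + 1000 + 143 * real (e + vsize (vlist vstr xs))"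
    by simp
  also have "\<dots> \<le> 143 * B + (1205 + real k * (\<bar>c (1 + \<gamma>)\<bar> + ?C * (2 + \<gamma>) + 402)) * nl"
  proof -
    have "205 * m + u + 1000 + 143 * z \<le> 143 * B + (1205 + v) * w"
      if "u \<le> v * w" "m \<le> w" "1 \<le> w" "z \<le> B" for m u v w z :: real
      using that by (simp add: distrib_right)
    from this[OF rk nl nl1 e(2)] show ?thesis .
  qed
  finally have "runs_within (decodep k p q) (Cell a (Cell (vstr T) (Cell (vstr I) (vstr3 y))))
      (vlist vstr3 (map (indexed T I) xs))
      (143 * B + (1205 + real k * (\<bar>c (1 + \<gamma>)\<bar> + ?C * (2 + \<gamma>) + 402)) * nl)"
    by (rule computes_runs_within[OF dec])
  moreover have "set (Ss k ! i) \<subseteq> A \<and> card (set (Ss k ! i)) \<le> l" if "i < n" for i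
  proof -
    have "Ss k ! i \<in> set (Ss k)" using Ss(1)[of k] that by simp
    with Ss(2)[of k] A[of k] have "set (Ss k ! i) \<subseteq> A" "length (Ss k ! i) \<le> k" by auto
    with kl card_length[of "Ss k ! i"] show ?thesis by simp
  qed
  moreover have "real (num_edits (E (remaining E y r))) \<le>
       (1 + \<epsilon>\<^sub>I) * real (ED (zip T I) (map snd (remaining E y r)))" for r
    using E unfolding script_def by blast
  ultimately show ?thesis
    using rounds xs(1,2) unfolding Ss_def nl_def by (intro that[of E xs]) simp_all
qed

section \<open>The indexed code and its decoder\<close>

lemma map_fst_indexed:
  "length T = length x \<Longrightarrow> length I = length x \<Longrightarrow> map fst (indexed T I x) = x"
  by (simp add: indexed_def)

text \<open>The first components of an indexed word give back the codeword, so injectivity is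
  inherited from \<open>C\<close>.\<close>

lemma encoding_indexed:
  assumes "encoding A k A n C" "T \<in> strings A\<^sub>s n" "I \<in> strings A\<^sub>I n" "finite A\<^sub>s" "finite A\<^sub>I"
  shows "encoding A k (A \<times> A\<^sub>s \<times> A\<^sub>I) n (\<lambda>m. indexed T I (C m))"
proof -
  have C: "length (C m) = n \<and> set (C m) \<subseteq> A" if "m \<in> strings A k" for m
    using assms(1) that by (auto simp: encoding_def strings_def)
  have "indexed T I (C m) \<in> strings (A \<times> A\<^sub>s \<times> A\<^sub>I) n" if "m \<in> strings A k" for m
  proof -
    have "set (indexed T I (C m)) \<subseteq> set (C m) \<times> set T \<times> set I"
      unfolding indexed_def by (auto dest: set_zip_leftD set_zip_rightD)
    with C[OF that] assms(2,3) show ?thesis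
      by (auto simp: strings_def length_indexed)
  qed
  moreover have "inj_on (\<lambda>m. indexed T I (C m)) (strings A k)"
  proof (rule inj_onI)
    fix m m' assume m: "m \<in> strings A k" "m' \<in> strings A k" "indexed T I (C m) = indexed T I (C m')"
    have len: "length T = n" "length I = n" using assms(2,3) by (auto simp: strings_def)
    have "map fst (indexed T I (C m)) = C m" "map fst (indexed T I (C m')) = C m'"
      using C[OF m(1)] C[OF m(2)] len by (auto intro: map_fst_indexed)
    with m(3) have "C m = C m'" by metis
    with assms(1) m show "m = m'" by (auto simp: encoding_def inj_on_def)
  qed
  ultimately show ?thesis using assms unfolding encoding_def by auto
qed

lemma runs_within_encodep:
  assumes "runs_within p (Cell a m) (vstr x) B" "n > 0" "length x = n" "length T = n" "length I = n"
  shows "runs_within (encodep p) (Cell a (Cell (vstr T) (Cell (vstr I) m))) (vstr3 (indexed T I x))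
    (300 * (B + real n))"
proof -
  from assms(1) obtain c where c: "computes p (Cell a m) (vstr x) c" "real (c + vsize (vstr x)) \<le> B"
    by (rule runs_within_computes)
  show ?thesis
  proof (rule computes_runs_within[OF computes_encodep[OF c(1)]])
    \<comment> \<open>Since \<open>n > 0\<close>, the additive constants are absorbed into
      \<open>300 * real n\<close>.\<close>
    have "real (c + 80 * length x + 150 + vsize (vstr3 (indexed T I x))) \<le> real c + 300 * real n"
      using assms length_indexed[of T x I] by (simp add: vsize_vstr3)
    also have "\<dots> \<le> 300 * (B + real n)" using c(2) by simp
    finally show "real (c + 80 * length x + 150 + vsize (vstr3 (indexed T I x))) \<le> 300 * (B + real n)" .
  qed (use assms in simp_all)
qed

lemma list_decodable_indexed:
  fixes A :: "nat set" and m :: nat and T I :: "nat list" and C :: "nat list \<Rightarrow> nat list"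
  defines "CW \<equiv> C ` strings A m"
  assumes \<epsilon>: "\<epsilon> > 0" and \<gamma>: "0 \<le> \<gamma>" and l: "\<gamma> \<le> real l * \<epsilon> / 3 - 1" and \<delta>: "\<delta> < 1 - \<alpha> - \<epsilon>"
    and n: "n > 0" and C: "encoding A m A n C" and rec: "list_recoverable CW A n \<alpha> l L"
    and q: "recovers_within q a CW A n \<alpha> l B"
    and T: "T \<in> strings A\<^sub>s n" and sync: "synchronization_string (\<epsilon>\<^sup>2 / (9 * (1 + \<gamma>))) T"
    and I: "I \<in> strings A\<^sub>I n" and p: "near_linear_indexing p (\<epsilon> / (3 * (1 + \<gamma> / 2))) c d A\<^sub>I I"
  defines kdef: "k \<equiv> nat \<lfloor>3 * (1 + \<gamma>) / \<epsilon>\<rfloor>"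
  shows "\<exists>D. list_decoder D (indexed T I ` CW) (A \<times> A\<^sub>s \<times> A\<^sub>I) n \<delta> \<gamma> L \<and>
    (\<forall>x\<in>indexed T I ` CW. \<forall>y\<in>corruptions (A \<times> A\<^sub>s \<times> A\<^sub>I) n \<delta> \<gamma> x.
       runs_within (decodep k p q) (Cell a (Cell (vstr T) (Cell (vstr I) (vstr3 y)))) (vlist vstr3 (D y))
         (143 * B + (1205 + real k * (\<bar>c (1 + \<gamma>)\<bar> + (real (ecost (edit_step k)) + 100) * (2 + \<gamma>) + 402)) *
           near_linear (d (1 + \<gamma>)) n))"
proof -
  let ?A = "A \<times> A\<^sub>s \<times> A\<^sub>I"
  let ?B = "143 * B + (1205 + real k * (\<bar>c (1 + \<gamma>)\<bar> + (real (ecost (edit_step k)) + 100) * (2 + \<gamma>) + 402)) *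
           near_linear (d (1 + \<gamma>)) n"
  have len: "length T = n" "length I = n" using T I by (auto simp: strings_def)
  have CW: "length x = n" if "x \<in> CW" for x using that C by (auto simp: CW_def encoding_def strings_def)
  \<comment> \<open>The upper estimate of the floor gives \<open>k \<le> l\<close>, by the
    assumption on \<gamma>, and limits the accumulated synchronization error; the lower one is what
    the count of unmatched symbols uses.\<close>
  have k_le: "real k \<le> 3 * (1 + \<gamma>) / \<epsilon>" and k_gt: "3 * (1 + \<gamma>) / \<epsilon> < real k + 1"
    using \<epsilon> \<gamma> unfolding kdef by (simp_all add: floor_less_iff) 
  have "3 * (1 + \<gamma>) / \<epsilon> \<le> real l" using l \<epsilon> by (simp add: field_simps)
  with k_le have kl: "k \<le> l" by simp
  have par: "real k * (\<epsilon>\<^sup>2 / (9 * (1 + \<gamma>))) \<le> \<epsilon> / 3"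
    "\<epsilon> / (3 * (1 + \<gamma> / 2)) * (1 + \<gamma> / 2) \<le> \<epsilon> / 3" "1 + \<gamma> \<le> (real k + 1) * (\<epsilon> / 3)"
  proof -
    have "real k * (\<epsilon>\<^sup>2 / (9 * (1 + \<gamma>))) \<le> 3 * (1 + \<gamma>) / \<epsilon> * (\<epsilon>\<^sup>2 / (9 * (1 + \<gamma>)))"
      using k_le \<gamma> by (intro mult_right_mono) auto
    also have "\<dots> = \<epsilon> / 3"
    proof -
      have "3 * g / \<epsilon> * (\<epsilon>\<^sup>2 / (9 * g)) = \<epsilon> / 3" if "g > 0" for g :: real
        using \<epsilon> that by (simp add: field_simps power2_eq_square)
      from this[of "1 + \<gamma>"] show ?thesis using \<gamma> by simp
    qed
    finally show "real k * (\<epsilon>\<^sup>2 / (9 * (1 + \<gamma>))) \<le> \<epsilon> / 3" .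
    show "\<epsilon> / (3 * (1 + \<gamma> / 2)) * (1 + \<gamma> / 2) \<le> \<epsilon> / 3"
    proof -
      have "\<epsilon> / (3 * g) * g = \<epsilon> / 3" if "g > 0" for g :: real using that by simp
      from this[of "1 + \<gamma> / 2"] show ?thesis using \<gamma> by simp
    qed
    show "1 + \<gamma> \<le> (real k + 1) * (\<epsilon> / 3)" using k_gt \<epsilon> by (simp add: field_simps)
  qed
  \<comment> \<open>The decoder sees only \<open>y\<close>, which may be a corruption of several
    codewords; one and the same list has to contain them all.\<close>
  define good where "good y ws \<longleftrightarrow> length ws \<le> L \<and> set ws \<subseteq> indexed T I ` CW \<and>
      (\<forall>x\<in>indexed T I ` CW. y \<in> corruptions ?A n \<delta> \<gamma> x \<longrightarrow> x \<in> set ws) \<and>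
      runs_within (decodep k p q) (Cell a (Cell (vstr T) (Cell (vstr I) (vstr3 y)))) (vlist vstr3 ws) ?B"
    for y ws
  have ex: "\<exists>ws. good y ws" if w: "x\<^sub>0 \<in> indexed T I ` CW" "y \<in> corruptions ?A n \<delta> \<gamma> x\<^sub>0" for x\<^sub>0 y
  proof -
    obtain x where "x \<in> CW" "x\<^sub>0 = indexed T I x" using w(1) by blast
    then have len0: "length x\<^sub>0 = n" using CW[of x] len length_indexed[of T x I] by simp
    obtain d0 i0 where i0: "set y \<subseteq> ?A" "real i0 \<le> \<gamma> * real n" "indel x\<^sub>0 d0 i0 y"
      using w(2) by (auto simp: corruptions_def)
    then have "length y + d0 = n + i0" using indel_matching[OF i0(3)] len0 by auto
    then have y: "real (length y) \<le> (1 + \<gamma>) * real n" using i0(2) by (simp add: algebra_simps)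
    obtain E xs where
      E: "rounds E y (zip T I) k"
      "\<forall>r<k. real (num_edits (E (remaining E y r))) \<le>
         (1 + \<epsilon> / (3 * (1 + \<gamma> / 2))) * real (ED (zip T I) (map snd (remaining E y r)))"
      "\<forall>i<n. set (symbol_lists E y n k ! i) \<subseteq> A \<and> card (set (symbol_lists E y n k ! i)) \<le> l"
      and xs: "distinct xs" "set xs = agreeing CW n \<alpha> (\<lambda>i. set (symbol_lists E y n k ! i))"
      "runs_within (decodep k p q) (Cell a (Cell (vstr T) (Cell (vstr I) (vstr3 y))))
         (vlist vstr3 (map (indexed T I) xs)) ?B"
      by (rule decode_word[OF n len p q CW i0(1) y kl])
    have "card (agreeing CW n \<alpha> (\<lambda>i. set (symbol_lists E y n k ! i))) \<le> L"
      using spec[OF rec[unfolded list_recoverable_def], of "\<lambda>i. set (symbol_lists E y n k ! i)"] E(3)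
      by simp
    then have "length xs \<le> L" using distinct_card[OF xs(1)] xs(2) by simp
    moreover have "indexed T I x \<in> set (map (indexed T I) xs)"
      if x: "x \<in> CW" and cor: "y \<in> corruptions ?A n \<delta> \<gamma> (indexed T I x)" for x
    proof -
      obtain d1 i1 where 1: "real d1 \<le> \<delta> * real n" "real i1 \<le> \<gamma> * real n" "indel (indexed T I x) d1 i1 y"
        using cor by (auto simp: corruptions_def)
      have "real n - real d1 - \<epsilon> * real n \<le>
          real (card {i. i < n \<and> x ! i \<in> set (symbol_lists E y n k ! i)})"
        by (rule rounds_agreement[OF CW[OF x] len 1(3,2) sync _ _ E(1) E(2)[rule_format] par])
          (use \<epsilon> \<gamma> in auto)
      \<comment> \<open>By the bound on \<delta>, what is left after the deletions and the loss of
        \<epsilon> n positions still reaches the recovery threshold.\<close>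
      moreover have "\<alpha> * real n \<le> (1 - \<delta> - \<epsilon>) * real n"
        using \<delta> by (intro mult_right_mono) auto
      ultimately have "\<alpha> * real n \<le> real (card {i. i < n \<and> x ! i \<in> set (symbol_lists E y n k ! i)})"
        using 1(1) by (simp add: algebra_simps)
      with x xs(2) show ?thesis by (auto simp: agreeing_def)
    qed
    moreover have "set (map (indexed T I) xs) \<subseteq> indexed T I ` CW"
      using xs(2) by (auto simp: agreeing_def)
    ultimately have "good y (map (indexed T I) xs)" unfolding good_def using xs(3) by auto
    then show ?thesis by blast
  qed
  define D where "D y = (SOME ws. good y ws)" for y
  have "good y (D y)" if "x \<in> indexed T I ` CW" "y \<in> corruptions ?A n \<delta> \<gamma> x" for x y
    unfolding D_def by (rule someI_ex[OF ex[OF that]])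
  then have D: "length (D y) \<le> L" "set (D y) \<subseteq> indexed T I ` CW" "x \<in> set (D y)"
    "runs_within (decodep k p q) (Cell a (Cell (vstr T) (Cell (vstr I) (vstr3 y)))) (vlist vstr3 (D y)) ?B"
    if "x \<in> indexed T I ` CW" "y \<in> corruptions ?A n \<delta> \<gamma> x" for x y
    using that unfolding good_def by metis+
  show ?thesis
    unfolding list_decoder_def
    by (intro exI[of _ D] conjI ballI) (rule D; assumption)+
qed

text \<open>The order of the quantifiers carries the O-notation: the constant of the encoder is
  absolute, constant and exponent of the decoder may depend on \<epsilon>, \<gamma> and the time
  bounds of the indexing algorithm but not on the code, and the same programs serve all block
  lengths.\<close>

theorem theorem7p4:
  shows
  "\<exists>c\<^sub>E::real.
   \<forall>(\<epsilon>::real) (\<gamma>::real) (c\<^sub>I :: real \<Rightarrow> real) (d\<^sub>I :: real \<Rightarrow> nat). \<epsilon> > 0 \<and> 0 \<le> \<gamma> \<longrightarrow>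
   (\<exists>(c\<^sub>D::real) (d\<^sub>D::nat).
    \<forall>(N :: nat set) (A :: nat \<Rightarrow> nat set) (A\<^sub>s :: nat \<Rightarrow> nat set) (A\<^sub>I :: nat \<Rightarrow> nat set)
     (R :: real) (k :: nat \<Rightarrow> nat) (C :: nat \<Rightarrow> nat list \<Rightarrow> nat list) (a :: nat \<Rightarrow> val)
     (\<alpha> :: real) (l :: nat) (L :: nat \<Rightarrow> nat) (\<delta> :: real)
     (T\<^sub>E :: nat \<Rightarrow> real) (T\<^sub>D :: nat \<Rightarrow> real) (p\<^sub>E :: prog) (p\<^sub>D :: prog) (p\<^sub>I :: prog)
     (T :: nat \<Rightarrow> nat list) (I :: nat \<Rightarrow> nat list).
     \<gamma> \<le> real l * \<epsilon> / 3 - 1 \<and> 0 \<le> \<delta> \<and> \<delta> < 1 - \<alpha> - \<epsilon> \<and>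
     (\<forall>n\<in>N. n > 0 \<and>
        real (k n) = real n * R \<and> encoding (A n) (k n) (A n) n (C n) \<and>
        list_recoverable (C n ` strings (A n) (k n)) (A n) n \<alpha> l (L n) \<and>
        (\<forall>m\<in>strings (A n) (k n). runs_within p\<^sub>E (Cell (a n) (vstr m)) (vstr (C n m)) (T\<^sub>E n)) \<and>
        recovers_within p\<^sub>D (a n) (C n ` strings (A n) (k n)) (A n) n \<alpha> l (T\<^sub>D n) \<and>
        finite (A\<^sub>s n) \<and> T n \<in> strings (A\<^sub>s n) n \<and>
        synchronization_string (\<epsilon>\<^sup>2 / (9 * (1 + \<gamma>))) (T n) \<and>
        finite (A\<^sub>I n) \<and> I n \<in> strings (A\<^sub>I n) n \<and>
        near_linear_indexing p\<^sub>I (\<epsilon> / (3 * (1 + \<gamma> / 2))) c\<^sub>I d\<^sub>I (A\<^sub>I n) (I n)) \<longrightarrow>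
     (\<exists>q\<^sub>E q\<^sub>D. \<forall>n\<in>N.
       (let B = A n \<times> A\<^sub>s n \<times> A\<^sub>I n;
            C' = (\<lambda>m. indexed (T n) (I n) (C n m));
            CW' = C' ` strings (A n) (k n);
            a' = (\<lambda>v. Cell (a n) (Cell (vstr (T n)) (Cell (vstr (I n)) v)))
        in encoding (A n) (k n) B n C' \<and>
           (\<forall>m\<in>strings (A n) (k n).
              runs_within q\<^sub>E (a' (vstr m)) (vstr3 (C' m)) (c\<^sub>E * (T\<^sub>E n + real n))) \<and>
           (\<exists>D. list_decoder D CW' B n \<delta> \<gamma> (L n) \<and>
              (\<forall>x\<in>CW'. \<forall>y\<in>corruptions B n \<delta> \<gamma> x.
                 runs_within q\<^sub>D (a' (vstr3 y)) (vlist vstr3 (D y))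
                   (c\<^sub>D * (T\<^sub>D n + near_linear d\<^sub>D n)))))))"
proof -
  \<comment> \<open>The claim with explicit programs and constants; \<open>K\<close> is the number
    of rounds.\<close>
  have main: "\<exists>q\<^sub>E q\<^sub>D. \<forall>n\<in>N.
       (let B = A n \<times> A\<^sub>s n \<times> A\<^sub>I n;
            C' = (\<lambda>m. indexed (T n) (I n) (C n m));
            CW' = C' ` strings (A n) (k n);
            a' = (\<lambda>v. Cell (a n) (Cell (vstr (T n)) (Cell (vstr (I n)) v)))
        in encoding (A n) (k n) B n C' \<and>
           (\<forall>m\<in>strings (A n) (k n).
              runs_within q\<^sub>E (a' (vstr m)) (vstr3 (C' m)) (300 * (T\<^sub>E n + real n))) \<and>
           (\<exists>D. list_decoder D CW' B n \<delta> \<gamma> (L n) \<and>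
              (\<forall>x\<in>CW'. \<forall>y\<in>corruptions B n \<delta> \<gamma> x.
                 runs_within q\<^sub>D (a' (vstr3 y)) (vlist vstr3 (D y))
                   (c\<^sub>D * (T\<^sub>D n + near_linear (d\<^sub>I (1 + \<gamma>)) n)))))"
    if eg: "\<epsilon> > 0" "0 \<le> \<gamma>"
      and K: "K = nat \<lfloor>3 * (1 + \<gamma>) / \<epsilon>\<rfloor>"
      and cD: "c\<^sub>D = 1205 + real K * (\<bar>c\<^sub>I (1 + \<gamma>)\<bar> + (real (ecost (edit_step K)) + 100) * (2 + \<gamma>) + 402)"
      and h: "\<gamma> \<le> real l * \<epsilon> / 3 - 1 \<and> 0 \<le> \<delta> \<and> \<delta> < 1 - \<alpha> - \<epsilon> \<and>
       (\<forall>n\<in>N. n > 0 \<and>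
        real (k n) = real n * R \<and> encoding (A n) (k n) (A n) n (C n) \<and>
        list_recoverable (C n ` strings (A n) (k n)) (A n) n \<alpha> l (L n) \<and>
        (\<forall>m\<in>strings (A n) (k n). runs_within p\<^sub>E (Cell (a n) (vstr m)) (vstr (C n m)) (T\<^sub>E n)) \<and>
        recovers_within p\<^sub>D (a n) (C n ` strings (A n) (k n)) (A n) n \<alpha> l (T\<^sub>D n) \<and>
        finite (A\<^sub>s n) \<and> T n \<in> strings (A\<^sub>s n) n \<and>
        synchronization_string (\<epsilon>\<^sup>2 / (9 * (1 + \<gamma>))) (T n) \<and>
        finite (A\<^sub>I n) \<and> I n \<in> strings (A\<^sub>I n) n \<and>
        near_linear_indexing p\<^sub>I (\<epsilon> / (3 * (1 + \<gamma> / 2))) c\<^sub>I d\<^sub>I (A\<^sub>I n) (I n))"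
    for \<epsilon> \<gamma> c\<^sub>I d\<^sub>I N A A\<^sub>s A\<^sub>I R k C a \<alpha> l L \<delta> T\<^sub>E T\<^sub>D p\<^sub>E p\<^sub>D p\<^sub>I T I K c\<^sub>D
  proof (rule exI[of _ "encodep p\<^sub>E"], rule exI[of _ "decodep K p\<^sub>I p\<^sub>D"], rule ballI)
    fix n assume "n \<in> N"
    with h have n: "n > 0" and enc: "encoding (A n) (k n) (A n) n (C n)"
      and rec: "list_recoverable (C n ` strings (A n) (k n)) (A n) n \<alpha> l (L n)"
      and pE: "\<And>m. m \<in> strings (A n) (k n) \<Longrightarrow> runs_within p\<^sub>E (Cell (a n) (vstr m)) (vstr (C n m)) (T\<^sub>E n)"
      and pD: "recovers_within p\<^sub>D (a n) (C n ` strings (A n) (k n)) (A n) n \<alpha> l (T\<^sub>D n)"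
      and fin: "finite (A\<^sub>s n)" "finite (A\<^sub>I n)"
      and T: "T n \<in> strings (A\<^sub>s n) n" "synchronization_string (\<epsilon>\<^sup>2 / (9 * (1 + \<gamma>))) (T n)"
      and I: "I n \<in> strings (A\<^sub>I n) n"
        "near_linear_indexing p\<^sub>I (\<epsilon> / (3 * (1 + \<gamma> / 2))) c\<^sub>I d\<^sub>I (A\<^sub>I n) (I n)"
      and par: "\<gamma> \<le> real l * \<epsilon> / 3 - 1" "\<delta> < 1 - \<alpha> - \<epsilon>"
      by auto
    \<comment> \<open>\<open>T\<^sub>D n\<close> bounds an actual run, here the one on
      \<open>n\<close> empty lists, so it is nonnegative. This permits replacing the factor 143 by
      the larger \<open>c\<^sub>D\<close>.\<close>
    have "0 \<le> T\<^sub>D n"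
    proof -
      obtain xs where "runs_within p\<^sub>D (Cell (a n) (vlist vstr (replicate n []))) (vlist vstr xs) (T\<^sub>D n)"
        using pD unfolding recovers_within_def by (auto dest: spec[of _ "replicate n []"])
      then show ?thesis unfolding runs_within_def by (meson of_nat_0_le_iff order.trans)
    qed
    moreover have "143 \<le> c\<^sub>D" unfolding cD using \<open>0 \<le> \<gamma>\<close> by simp
    ultimately have time: "143 * T\<^sub>D n + c\<^sub>D * near_linear (d\<^sub>I (1 + \<gamma>)) n \<le>
        c\<^sub>D * (T\<^sub>D n + near_linear (d\<^sub>I (1 + \<gamma>)) n)"
      by (simp add: distrib_left mult_right_mono)
    have encode: "\<forall>m\<in>strings (A n) (k n).
      runs_within (encodep p\<^sub>E) (Cell (a n) (Cell (vstr (T n)) (Cell (vstr (I n)) (vstr m))))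
        (vstr3 (indexed (T n) (I n) (C n m))) (300 * (T\<^sub>E n + real n))"
      using enc T(1) I(1)
      by (intro ballI runs_within_encodep[OF pE n]) (auto simp: encoding_def strings_def)
    have mono: "runs_within p v w b \<Longrightarrow> b \<le> b' \<Longrightarrow> runs_within p v w b'" for p v w b b'
      unfolding runs_within_def using order.trans by blast
    obtain D where D: "list_decoder D (indexed (T n) (I n) ` C n ` strings (A n) (k n))
        (A n \<times> A\<^sub>s n \<times> A\<^sub>I n) n \<delta> \<gamma> (L n)"
      "\<forall>x\<in>indexed (T n) (I n) ` C n ` strings (A n) (k n).
        \<forall>y\<in>corruptions (A n \<times> A\<^sub>s n \<times> A\<^sub>I n) n \<delta> \<gamma> x.
          runs_within (decodep K p\<^sub>I p\<^sub>D) (Cell (a n) (Cell (vstr (T n)) (Cell (vstr (I n)) (vstr3 y))))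
            (vlist vstr3 (D y)) (143 * T\<^sub>D n + c\<^sub>D * near_linear (d\<^sub>I (1 + \<gamma>)) n)"
      using list_decodable_indexed[OF eg par n enc rec pD T I] unfolding K cD by blast
    note decode = mono[OF D(2)[rule_format] time]
    show "let B = A n \<times> A\<^sub>s n \<times> A\<^sub>I n;
            C' = (\<lambda>m. indexed (T n) (I n) (C n m));
            CW' = C' ` strings (A n) (k n);
            a' = (\<lambda>v. Cell (a n) (Cell (vstr (T n)) (Cell (vstr (I n)) v)))
        in encoding (A n) (k n) B n C' \<and>
           (\<forall>m\<in>strings (A n) (k n).
              runs_within (encodep p\<^sub>E) (a' (vstr m)) (vstr3 (C' m)) (300 * (T\<^sub>E n + real n))) \<and>
           (\<exists>D. list_decoder D CW' B n \<delta> \<gamma> (L n) \<and>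
              (\<forall>x\<in>CW'. \<forall>y\<in>corruptions B n \<delta> \<gamma> x.
                 runs_within (decodep K p\<^sub>I p\<^sub>D) (a' (vstr3 y)) (vlist vstr3 (D y))
                   (c\<^sub>D * (T\<^sub>D n + near_linear (d\<^sub>I (1 + \<gamma>)) n))))"
      unfolding Let_def
      by (intro conjI exI[of _ D] ballI encoding_indexed[OF enc T(1) I(1) fin] encode[rule_format]
          D(1)[unfolded image_image] decode[unfolded image_image])
  qed
  show ?thesis
    by (rule exI[of _ 300], intro allI impI, elim conjE, rule exI, rule exI, intro allI impI,
        rule main[OF _ _ HOL.refl HOL.refl])
qed

end
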